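(* Let $\mathcal{H}\in C^1(\mathbb{S}^2)$. Let $\Pi\subset\mathbb{R}^3$ be a plane, let $\Gamma\subset\Pi$ be a closed simple curve that bounds a domain $\Omega\subset\Pi$, and let $\mathrm{ext}(\Omega)=\Pi\setminus\overline{\Omega}$. If $M$ is a compact, embedded $\mathcal{H}$-surface that spans $\Gamma$ and $M\cap\mathrm{ext}(\Omega)=\varnothing$, then $\mathrm{int}(M)$ is contained in one of the two closed half-spaces determined by $\Pi$.
   Context: $\mathbb{S}^2$ is the unit sphere of $\mathbb{R}^3$. Surfaces are smooth, connected and oriented, possibly with boundary, with Gauss map (unit normal field) $N:M\to\mathbb{S}^2$; $\mathrm{int}(M)=M\setminus\partial M$. The mean curvature $H_M$ is the average of the principal curvatures with respect to $N$, with the sign convention that the graph of $u$ oriented by $N=(-Du,1)/\sqrt{1+|Du|^2}$ has $2H_M=\mathrm{div}\big(Du/\sqrt{1+|Du|^2}\big)$. Given $\mathcal{H}\in C^1(\mathbb{S}^2)$, an $\mathcal{H}$-surface is a surface $M$ such that $H_M(p)=\mathcal{H}(N_p)$ for all $p\in M$. $M$ spans $\Gamma$ if the immersion restricted to $\partial M$ is a diffeomorphism onto $\Gamma$. *)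

theory Defs
  imports "HOL-Analysis.Analysis"
begin

section \<open>Functions of class \<open>C\<^sup>k\<close>\<close>

text \<open>Intended for open sets \<open>S\<close>.\<close>

primrec Ck_on :: "nat \<Rightarrow> ('a::euclidean_space \<Rightarrow> 'b::euclidean_space) \<Rightarrow> 'a set \<Rightarrow> bool" where
  "Ck_on 0 f S \<longleftrightarrow> continuous_on S f"
| "Ck_on (Suc k) f S \<longleftrightarrow>
     (\<forall>x\<in>S. f differentiable (at x)) \<and>
     (\<forall>i\<in>Basis. Ck_on k (\<lambda>x. frechet_derivative f (at x) i) S)"

definition smooth_on :: "('a::euclidean_space \<Rightarrow> 'b::euclidean_space) \<Rightarrow> 'a set \<Rightarrow> bool" where
  "smooth_on f S \<longleftrightarrow> (\<forall>k. Ck_on k f S)"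

text \<open>Functions on a submanifold \<open>S\<close> of Euclidean space (here: the unit sphere) are of class
  \<open>C\<^sup>k\<close> if they extend locally to \<open>C\<^sup>k\<close> functions on open sets.\<close>

definition Ck_on_submanifold ::
  "nat \<Rightarrow> ('a::euclidean_space \<Rightarrow> 'b::euclidean_space) \<Rightarrow> 'a set \<Rightarrow> bool" where
  "Ck_on_submanifold k f S \<longleftrightarrow>
     (\<forall>p\<in>S. \<exists>U g. open U \<and> p \<in> U \<and> Ck_on k g U \<and> (\<forall>x\<in>S \<inter> U. g x = f x))"

section \<open>Embedded surfaces with boundary\<close>

definition half_plane :: "(real^2) set" where
  "half_plane = {x. 0 \<le> x $ 2}"

text \<open>A local parametrization of \<open>M\<close> is the restriction to \<open>V \<inter> half_plane\<close> of a smooth map defined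
  on the open set \<open>V\<close> of the plane, so that it is smooth up to the boundary; \<open>V\<close> need not meet the
  boundary line of the half-plane.\<close>

definition local_param :: "(real^3) set \<Rightarrow> (real^2 \<Rightarrow> real^3) \<Rightarrow> (real^2) set \<Rightarrow> bool" where
  "local_param M \<phi> V \<longleftrightarrow>
     open V \<and> smooth_on \<phi> V \<and>
     (\<forall>x\<in>V \<inter> half_plane. inj (frechet_derivative \<phi> (at x))) \<and>
     openin (top_of_set M) (\<phi> ` (V \<inter> half_plane)) \<and>
     (\<exists>\<psi>. homeomorphism (V \<inter> half_plane) (\<phi> ` (V \<inter> half_plane)) \<phi> \<psi>)"

definition embedded_surface :: "(real^3) set \<Rightarrow> bool" where
  "embedded_surface M \<longleftrightarrow>
     (\<forall>p\<in>M. \<exists>\<phi> V. local_param M \<phi> V \<and> p \<in> \<phi> ` (V \<inter> half_plane))"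

definition surface_boundary :: "(real^3) set \<Rightarrow> (real^3) set" where
  "surface_boundary M =
     {p. \<exists>\<phi> V x. local_param M \<phi> V \<and> x \<in> V \<and> x $ 2 = 0 \<and> \<phi> x = p}"

definition surface_interior :: "(real^3) set \<Rightarrow> (real^3) set" where
  "surface_interior M = M - surface_boundary M"

text \<open>At boundary points this is the full tangent plane, not a half-plane.\<close>

definition tangent_plane :: "(real^3) set \<Rightarrow> real^3 \<Rightarrow> (real^3) set" where
  "tangent_plane M p =
     {v. \<exists>\<phi> V x. local_param M \<phi> V \<and> x \<in> V \<inter> half_plane \<and> \<phi> x = p \<and>
           v \<in> range (frechet_derivative \<phi> (at x))}"

text \<open>A continuous unit normal field of a smooth surface is automatically smooth.\<close>

definition gauss_map :: "(real^3) set \<Rightarrow> (real^3 \<Rightarrow> real^3) \<Rightarrow> bool" where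
  "gauss_map M N \<longleftrightarrow>
     continuous_on M N \<and>
     (\<forall>p\<in>M. N p \<in> sphere 0 1 \<and> (\<forall>v\<in>tangent_plane M p. N p \<bullet> v = 0))"

text \<open>The principal curvatures are the eigenvalues of the shape operator \<open>-dN\<^sub>p\<close> on the tangent plane,
  counted with multiplicity. A derivative \<open>D\<close> of \<open>N\<close> at \<open>p\<close> within \<open>M\<close> is uniquely determined only on
  the tangent plane, and only its values there are used. With the minus sign, the graph of \<open>u\<close> with
  upward normal \<open>(-Du, 1) / sqrt (1 + |Du|\<^sup>2)\<close> has mean curvature \<open>H\<close> given by
  \<open>2 H = div (Du / sqrt (1 + |Du|\<^sup>2))\<close>.\<close>

definition principal_curvatures ::
  "(real^3) set \<Rightarrow> (real^3 \<Rightarrow> real^3) \<Rightarrow> real^3 \<Rightarrow> real \<Rightarrow> real \<Rightarrow> bool" where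
  "principal_curvatures M N p \<kappa>1 \<kappa>2 \<longleftrightarrow>
     (\<exists>D e1 e2. (N has_derivative D) (at p within M) \<and>
        e1 \<in> tangent_plane M p \<and> e2 \<in> tangent_plane M p \<and>
        norm e1 = 1 \<and> norm e2 = 1 \<and> e1 \<bullet> e2 = 0 \<and>
        - D e1 = \<kappa>1 *\<^sub>R e1 \<and> - D e2 = \<kappa>2 *\<^sub>R e2)"

text \<open>The shape operator is self-adjoint, so there is always exactly one such \<open>h\<close> at each point of
  an oriented surface, namely half the trace of the shape operator.\<close>

definition has_mean_curvature ::
  "(real^3) set \<Rightarrow> (real^3 \<Rightarrow> real^3) \<Rightarrow> real^3 \<Rightarrow> real \<Rightarrow> bool" where
  "has_mean_curvature M N p h \<longleftrightarrow>
     (\<exists>\<kappa>1 \<kappa>2. principal_curvatures M N p \<kappa>1 \<kappa>2 \<and> h = (\<kappa>1 + \<kappa>2) / 2)"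

definition embedded_H_surface ::
  "(real^3 \<Rightarrow> real) \<Rightarrow> (real^3) set \<Rightarrow> (real^3 \<Rightarrow> real^3) \<Rightarrow> bool" where
  "embedded_H_surface \<H> M N \<longleftrightarrow>
     embedded_surface M \<and> connected M \<and> gauss_map M N \<and>
     (\<forall>p\<in>M. has_mean_curvature M N p (\<H> (N p)))"

section \<open>Curves, spanning surfaces and planar domains\<close>

definition simple_closed_curve :: "(real^3) set \<Rightarrow> bool" where
  "simple_closed_curve \<Gamma> \<longleftrightarrow>
     (\<exists>\<gamma>. simple_path \<gamma> \<and> pathfinish \<gamma> = pathstart \<gamma> \<and> path_image \<gamma> = \<Gamma>)"

text \<open>An embedded surface is identified with its image, so its immersion is the inclusion. Its
  restriction to the boundary curve, a smooth submanifold, is a diffeomorphism onto \<open>\<Gamma>\<close> if and only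
  if the boundary is \<open>\<Gamma>\<close>; in particular \<open>\<Gamma>\<close> is then smooth.\<close>

definition spans :: "(real^3) set \<Rightarrow> (real^3) set \<Rightarrow> bool" where
  "spans M \<Gamma> \<longleftrightarrow> surface_boundary M = \<Gamma>"

text \<open>Boundedness selects the inner one of the two components of \<open>P - \<Gamma>\<close>, both of which have
  frontier \<open>\<Gamma>\<close> in the plane \<open>P\<close>.\<close>

definition bounds_domain_in :: "(real^3) set \<Rightarrow> (real^3) set \<Rightarrow> (real^3) set \<Rightarrow> bool" where
  "bounds_domain_in P \<Gamma> \<Omega> \<longleftrightarrow>
     openin (top_of_set P) \<Omega> \<and> connected \<Omega> \<and> bounded \<Omega> \<and> (top_of_set P) frontier_of \<Omega> = \<Gamma>"

end

theory Submission
  imports Defs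
begin

text \<open>Suppose that \<open>M\<close> has points strictly on both sides of the plane \<open>P\<close>.  A highest point \<open>p\<close> and a
  lowest point \<open>q\<close> of \<open>M\<close> then lie off the plane, hence in the interior of \<open>M\<close>, and both normals are
  vertical.

  The first half of the proof is topological and shows that the two normals are equal
  (\<open>normals_at_extremal_points_agree\<close>).  Intuitively, \<open>M\<close> together with the exterior of \<open>\<Omega>\<close> in the
  plane separates space into two parts, one containing the points far above and the other the points
  far below, and the normal of \<open>M\<close> points into the same part everywhere; so it points up at both
  \<open>p\<close> and \<open>q\<close>, or down at both.  To avoid the corner along the boundary curve, separation is
  expressed by logarithms.  There is a map from the complement of \<open>\<Gamma>\<close> to the punctured complex plane
  that crosses the positive real axis exactly along the interior of \<open>M\<close>, in the direction of the
  normal (\<open>crossing_map\<close>).  On each of the two closed half-spaces without \<open>\<Gamma>\<close>, which are starlike, it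
  has a logarithm, and the two logarithms can be adjusted to agree on \<open>\<Omega>\<close>, because \<open>\<Omega>\<close> is connected.
  The imaginary part then has one and the same value on the whole interior of \<open>M\<close>.  If the normals
  at \<open>p\<close> and \<open>q\<close> were opposite, both logarithms would be on the same sheet far away in the plane;
  since the exterior of \<open>\<Omega>\<close> is connected by the Jordan curve theorem, they would agree there as well
  and give a logarithm on the whole complement of \<open>\<Gamma>\<close>.  That is impossible near a point of \<open>\<Gamma>\<close>
  (\<open>no_logarithm_around_boundary\<close>): there one can walk around the edge of \<open>M\<close> from one side to
  the other, although the sheet changes when \<open>M\<close> is crossed.

  The second half is a maximum principle.  Let \<open>\<nu>\<close> be the common normal at \<open>p\<close> and \<open>q\<close>.  The second
  order conditions at the maximum and at the minimum of the height give opposite weak inequalities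
  for \<open>\<H> \<nu>\<close>, so \<open>\<H> \<nu> = 0\<close>.  Therefore the horizontal plane through \<open>p\<close>, oriented by \<open>\<nu>\<close>, has the prescribed
  curvature too, and \<open>M\<close> touches it from one side.  As \<open>\<H>\<close> is Lipschitz at \<open>\<nu>\<close>, Hopf's barrier argument
  shows that the set of contact is open in \<open>M\<close> (\<open>touching_set_open\<close>).  By connectedness \<open>M\<close> lies in
  that plane, which contradicts the existence of \<open>q\<close>.

  The local structure of the surface enters the topological part through boxes in which it is nearly
  flat (\<open>flat_chart\<close>); the curvature enters the maximum principle through the second order condition
  for the maximum of a function on the surface (\<open>mean_curvature_inequality_at_max\<close>).\<close>

section \<open>Strict differentiability of \<open>C\<^sup>1\<close> functions\<close>

lemma frechet_derivative_basis_expansion: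
  fixes f :: "'a::euclidean_space \<Rightarrow> 'b::euclidean_space"
  assumes "f differentiable (at x)"
  shows "frechet_derivative f (at x) w
           = (\<Sum>i\<in>Basis. (w \<bullet> i) *\<^sub>R frechet_derivative f (at x) i)"
proof -
  have lin: "linear (frechet_derivative f (at x))"
    using assms by (rule linear_frechet_derivative)
  have "frechet_derivative f (at x) w
          = frechet_derivative f (at x) (\<Sum>i\<in>Basis. (w \<bullet> i) *\<^sub>R i)"
    by (simp add: euclidean_representation)
  also have "\<dots> = (\<Sum>i\<in>Basis. (w \<bullet> i) *\<^sub>R frechet_derivative f (at x) i)"
    by (simp add: linear_sum[OF lin] linear_cmul[OF lin])
  finally show ?thesis .
qed

lemma Ck_on_1_imp_has_derivative:
  assumes "Ck_on 1 f S" "x \<in> S"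
  shows "(f has_derivative frechet_derivative f (at x)) (at x)"
  using assms by (auto simp: One_nat_def frechet_derivative_works[symmetric])

lemma Ck_on_1_imp_continuous_on:
  assumes "Ck_on 1 f S"
  shows "continuous_on S f"
  using assms differentiable_imp_continuous_within
  by (force simp: One_nat_def intro!: continuous_at_imp_continuous_on)

lemma Ck_on_1_continuous_directional_derivative:
  fixes f :: "'a::euclidean_space \<Rightarrow> 'b::euclidean_space"
  assumes "Ck_on 1 f S"
  shows "continuous_on S (\<lambda>x. frechet_derivative f (at x) w)"
proof -
  have "continuous_on S (\<lambda>x. \<Sum>i\<in>Basis. (w \<bullet> i) *\<^sub>R frechet_derivative f (at x) i)"
    using assms by (auto simp: One_nat_def intro!: continuous_intros)
  moreover have "f differentiable (at x)" if "x \<in> S" for x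
    using assms that by (auto simp: One_nat_def)
  ultimately show ?thesis
    by (subst continuous_on_cong[OF refl frechet_derivative_basis_expansion]) auto
qed

text \<open>The derivative of a \<open>C\<^sup>1\<close> function is strict: continuity of the derivative, together with the
  mean value inequality on a small ball, bounds the linearization error of differences.\<close>

lemma Ck_on_1_strict_derivative:
  fixes f :: "'a::euclidean_space \<Rightarrow> 'b::euclidean_space"
  assumes "open V" "Ck_on 1 f V" "x0 \<in> V" "\<eta> > 0"
  obtains r where "r > 0" "ball x0 r \<subseteq> V"
    "\<And>x y. x \<in> ball x0 r \<Longrightarrow> y \<in> ball x0 r \<Longrightarrow>
        norm (f x - f y - frechet_derivative f (at x0) (x - y)) \<le> \<eta> * norm (x - y)"
proof -
  define A where "A x = frechet_derivative f (at x)" for x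
  define S where "S x = (\<Sum>i\<in>Basis. norm (A x i - A x0 i))" for x
  have der: "(f has_derivative A x) (at x)" if "x \<in> V" for x
    using Ck_on_1_imp_has_derivative[OF assms(2) that] by (simp add: A_def)
  have "continuous_on V S"
    unfolding S_def A_def
    by (intro continuous_intros Ck_on_1_continuous_directional_derivative assms)
  then have "isCont S x0"
    using assms by (simp add: continuous_on_eq_continuous_at)
  moreover have "S x0 = 0" by (simp add: S_def)
  ultimately obtain d where d: "d > 0" "\<And>x. dist x x0 < d \<Longrightarrow> \<bar>S x\<bar> < \<eta>"
    using assms(4) unfolding continuous_at_eps_delta dist_real_def by fastforce
  obtain e where e: "e > 0" "ball x0 e \<subseteq> V"
    using assms by (meson openE)
  define r where "r = min d e"
  have sub: "ball x0 r \<subseteq> V" using e by (auto simp: r_def)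
  have bound: "onorm (\<lambda>h. A x h - A x0 h) \<le> \<eta>" if x: "x \<in> ball x0 r" for x
  proof (rule onorm_le)
    fix h
    have xV: "x \<in> V" using x sub by blast
    have "A x h - A x0 h = (\<Sum>i\<in>Basis. (h \<bullet> i) *\<^sub>R (A x i - A x0 i))"
      using frechet_derivative_basis_expansion[of f x h] frechet_derivative_basis_expansion[of f x0 h]
        assms(2,3) xV
      by (auto simp: A_def One_nat_def scaleR_diff_right sum_subtractf)
    also have "norm \<dots> \<le> (\<Sum>i\<in>Basis. norm h * norm (A x i - A x0 i))"
      by (rule order_trans[OF norm_sum sum_mono]) (auto intro: mult_right_mono Basis_le_norm)
    also have "\<dots> = norm h * S x" by (simp add: S_def sum_distrib_left)
    also have "\<dots> \<le> norm h * \<eta>"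
      using d(2)[of x] x by (intro mult_left_mono) (auto simp: r_def dist_commute)
    finally show "norm (A x h - A x0 h) \<le> \<eta> * norm h" by (simp add: mult.commute)
  qed
  have linA: "bounded_linear (A x0)"
    using der[OF assms(3)] by (rule has_derivative_bounded_linear)
  show thesis
  proof
    show "r > 0" using d e by (auto simp: r_def)
    show "ball x0 r \<subseteq> V" by fact
    fix x y assume xy: "x \<in> ball x0 r" "y \<in> ball x0 r"
    have "((\<lambda>x. f x - A x0 x) has_derivative (\<lambda>h. A x h - A x0 h)) (at x within ball x0 r)"
      if "x \<in> ball x0 r" for x
      using that sub
      by (intro has_derivative_diff has_derivative_at_withinI[OF der] bounded_linear_imp_has_derivative[OF linA]) auto
    from differentiable_bound[OF convex_ball this bound xy]
    have "norm (f x - A x0 x - (f y - A x0 y)) \<le> \<eta> * norm (x - y)" .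
    then show "norm (f x - f y - frechet_derivative f (at x0) (x - y)) \<le> \<eta> * norm (x - y)"
      unfolding A_def[symmetric] linear_diff[OF bounded_linear.linear[OF linA]]
      by (simp add: algebra_simps)
  qed
qed

section \<open>Flat charts\<close>

lemma local_paramD:
  assumes "local_param M \<phi> V"
  shows "open V" "Ck_on 1 \<phi> V" "\<phi> ` (V \<inter> half_plane) \<subseteq> M"
    "\<And>x. x \<in> V \<Longrightarrow> (\<phi> has_derivative frechet_derivative \<phi> (at x)) (at x)"
proof -
  show *: "Ck_on 1 \<phi> V" using assms by (auto simp: local_param_def smooth_on_def)
  show "\<And>x. x \<in> V \<Longrightarrow> (\<phi> has_derivative frechet_derivative \<phi> (at x)) (at x)"
    using Ck_on_1_imp_has_derivative[OF *] .
  show "open V" "\<phi> ` (V \<inter> half_plane) \<subseteq> M"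
    using assms openin_imp_subset by (fastforce simp: local_param_def)+
qed

lemma gauss_mapD:
  assumes "gauss_map M N" "p \<in> M"
  shows "norm (N p) = 1" "N p \<bullet> N p = 1" "\<And>v. v \<in> tangent_plane M p \<Longrightarrow> N p \<bullet> v = 0"
proof -
  show 1: "norm (N p) = 1" using assms by (auto simp: gauss_map_def)
  show "N p \<bullet> N p = 1" using 1 by (simp add: dot_square_norm)
  show "\<And>v. v \<in> tangent_plane M p \<Longrightarrow> N p \<bullet> v = 0" using assms by (auto simp: gauss_map_def)
qed

lemma tangent_planeI:
  assumes "local_param M \<phi> V" "x \<in> V \<inter> half_plane"
  shows "frechet_derivative \<phi> (at x) w \<in> tangent_plane M (\<phi> x)"
  using assms unfolding tangent_plane_def by blast

text \<open>Moving the points of a chart along a fixed normal gives a map of a box in \<open>\<real>\<^sup>3\<close> that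
  distorts differences little, because the derivative of the chart is strict; it is therefore
  injective and, by invariance of domain, a homeomorphism onto an open set.  The last coordinate is
  then a defining function of the surface whose increments agree, up to half the distance, with those
  of the linear function with gradient the normal.\<close>

lemma flat_chart:
  assumes lp: "local_param M \<phi> V" and x0: "x0 \<in> V \<inter> half_plane" "\<phi> x0 = p"
    and N: "gauss_map M N" and U: "open U" "p \<in> U" and \<rho>: "\<rho> > 0"
  obtains r O' \<Theta> where "r > 0" "r \<le> \<rho>" "ball x0 r \<subseteq> V" "open O'" "p \<in> O'" "O' \<subseteq> U"
    "homeomorphism (ball x0 r \<times> {-r<..<r}) O' (\<lambda>w. \<phi> (fst w) + snd w *\<^sub>R N p) \<Theta>"
    "M \<inter> O' = \<phi> ` (ball x0 r \<inter> half_plane)"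
    "\<And>x y. x \<in> O' \<Longrightarrow> y \<in> O' \<Longrightarrow>
       \<bar>N p \<bullet> (x - y) - (snd (\<Theta> x) - snd (\<Theta> y))\<bar> \<le> norm (x - y) / 2"
proof -
  note lpD = local_paramD[OF lp]
  define n where "n = N p"
  define A where "A = frechet_derivative \<phi> (at x0)"
  define \<Phi> where "\<Phi> w = \<phi> (fst w) + snd w *\<^sub>R n" for w
  have pM: "p \<in> M" using lpD x0 by auto
  have n1: "n \<bullet> n = 1" "norm n = 1" using gauss_mapD[OF N pM] by (auto simp: n_def)
  have nA: "n \<bullet> A w = 0" for w
    using gauss_mapD(3)[OF N pM] tangent_planeI[OF lp x0(1)] x0 by (auto simp: n_def A_def)
  have linA: "linear A"
    using lpD(4)[of x0] x0 has_derivative_linear by (auto simp: A_def)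
  have "inj A" using lp x0 by (auto simp: local_param_def A_def)
  with linA obtain c where c: "c > 0" "\<And>w. c * norm w \<le> norm (A w)"
    using linear_inj_bounded_below_pos[of A] by (metis mult.commute)
  \<comment> \<open>An error of \<open>c / 4\<close> in parameter differences is at most half the distance in space.\<close>
  obtain r1 where r1: "r1 > 0" "ball x0 r1 \<subseteq> V"
    "\<And>x y. x \<in> ball x0 r1 \<Longrightarrow> y \<in> ball x0 r1 \<Longrightarrow> norm (\<phi> x - \<phi> y - A (x - y)) \<le> c / 4 * norm (x - y)"
    using Ck_on_1_strict_derivative[OF lpD(1,2), of x0 "c/4"] x0 c unfolding A_def by auto
  define D1 where "D1 = ball x0 r1 \<times> (UNIV :: real set)"
  have est: "norm (fst w - fst w') \<le> 4 / (3 * c) * norm (\<Phi> w - \<Phi> w')"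
       "\<bar>n \<bullet> (\<Phi> w - \<Phi> w') - (snd w - snd w')\<bar> \<le> norm (\<Phi> w - \<Phi> w') / 2"
    if "w \<in> D1" "w' \<in> D1" for w w'
  proof -
    define u where "u = fst w - fst w'"
    define s where "s = snd w - snd w'"
    define E where "E = \<phi> (fst w) - \<phi> (fst w') - A u"
    define X where "X = \<Phi> w - \<Phi> w'"
    have X: "X = A u + s *\<^sub>R n + E"
      by (simp add: X_def \<Phi>_def E_def s_def algebra_simps)
    have E: "norm E \<le> c / 4 * norm u"
      unfolding E_def u_def using that by (intro r1) (auto simp: D1_def mem_Times_iff)
    have "(norm (A u))\<^sup>2 \<le> (norm (A u + s *\<^sub>R n))\<^sup>2"
      using n1 nA[of u] by (simp add: power2_norm_eq_inner inner_add_left inner_add_right inner_commute)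
    then have "c * norm u \<le> norm (X - E)"
      using c(2)[of u] X by (simp add: power2_le_iff_abs_le)
    also have "\<dots> \<le> norm X + norm E" by (rule norm_triangle_ineq4)
    finally have 1: "3 * (c * norm u) \<le> 4 * norm X" using E by (simp add: field_simps)
    then show "norm (fst w - fst w') \<le> 4 / (3 * c) * norm (\<Phi> w - \<Phi> w')"
      using c by (simp add: u_def X_def field_simps)
    have "n \<bullet> X - s = n \<bullet> E" using nA n1 by (simp add: X inner_add_right)
    moreover have "\<bar>n \<bullet> E\<bar> \<le> norm E" using Cauchy_Schwarz_ineq2[of n E] n1 by simp
    ultimately show "\<bar>n \<bullet> (\<Phi> w - \<Phi> w') - (snd w - snd w')\<bar> \<le> norm (\<Phi> w - \<Phi> w') / 2"
      using 1 E norm_ge_zero[of X] unfolding X_def[symmetric] s_def[symmetric] by linarith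
  qed
  have inj: "inj_on \<Phi> D1"
  proof (rule inj_onI)
    fix w w' assume *: "w \<in> D1" "w' \<in> D1" "\<Phi> w = \<Phi> w'"
    show "w = w'" using est[OF *(1,2)] *(3) by (auto simp: prod_eq_iff)
  qed
  have cont: "continuous_on D1 \<Phi>"
    unfolding \<Phi>_def D1_def
    by (intro continuous_intros continuous_on_compose2[OF Ck_on_1_imp_continuous_on[OF lpD(2)]])
       (use r1 in auto)
  have openD1: "open D1" by (auto simp: D1_def intro: open_Times)
  obtain T where T: "open T" "\<phi> ` (ball x0 r1 \<inter> half_plane) = M \<inter> T"
  proof -
    obtain \<psi> where \<psi>: "homeomorphism (V \<inter> half_plane) (\<phi> ` (V \<inter> half_plane)) \<phi> \<psi>"
      and op: "openin (top_of_set M) (\<phi> ` (V \<inter> half_plane))"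
      using lp by (auto simp: local_param_def)
    have "openin (top_of_set (V \<inter> half_plane)) (ball x0 r1 \<inter> half_plane)"
      using r1(2) by (auto simp: openin_open intro!: exI[of _ "ball x0 r1"])
    from homeomorphism_imp_open_map[OF \<psi> this] op
    have "openin (top_of_set M) (\<phi> ` (ball x0 r1 \<inter> half_plane))"
      by (rule openin_trans)
    then show thesis using that by (auto simp: openin_open)
  qed
  have "p \<in> T" using T(2) x0 r1 by (metis IntD2 IntI centre_in_ball imageI)
  have "open (D1 \<inter> \<Phi> -` (U \<inter> T))"
    using continuous_open_preimage[OF cont openD1 open_Int[OF U(1) T(1)]] .
  moreover have "(x0, 0) \<in> D1 \<inter> \<Phi> -` (U \<inter> T)"
    using r1 x0 U \<open>p \<in> T\<close> by (auto simp: D1_def \<Phi>_def)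
  ultimately obtain e where e: "e > 0" "ball (x0, 0) e \<subseteq> D1 \<inter> \<Phi> -` (U \<inter> T)"
    by (meson openE)
  define r where "r = min (e / 2) \<rho>"
  define D where "D = ball x0 r \<times> {-r<..<r}"
  have r0: "r > 0" "r \<le> \<rho>" using e \<rho> by (auto simp: r_def)
  have "D \<subseteq> ball (x0, 0) e"
  proof
    fix w assume "w \<in> D"
    then have "dist x0 (fst w) < e/2" "\<bar>snd w\<bar> < e/2" by (auto simp: D_def r_def)
    moreover have "dist (x0, 0) w \<le> dist x0 (fst w) + \<bar>snd w\<bar>"
      using norm_Pair_le[of "x0 - fst w" "0 - snd w"] by (cases w) (auto simp: dist_norm)
    ultimately show "w \<in> ball (x0, 0) e" by simp
  qed
  then have D: "D \<subseteq> D1" "\<Phi> ` D \<subseteq> U" "\<Phi> ` D \<subseteq> T" using e by auto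
  have openD: "open D" by (auto simp: D_def intro: open_Times)
  have injD: "inj_on \<Phi> D" and contD: "continuous_on D \<Phi>"
    using inj_on_subset[OF inj D(1)] continuous_on_subset[OF cont D(1)] by simp_all
  have openO: "open (\<Phi> ` D)"
    by (rule invariance_of_domain_gen[OF openD contD injD]) simp
  obtain \<Theta> where \<Theta>: "homeomorphism D (\<Phi> ` D) \<Phi> \<Theta>"
    by (rule invariance_of_domain_homeomorphism[OF openD contD _ injD]) auto
  show thesis
  proof
    show "r > 0" "r \<le> \<rho>" "open (\<Phi> ` D)" "\<Phi> ` D \<subseteq> U" by fact+
    have "(v, 0) \<in> D" if "v \<in> ball x0 r" for v using that r0 by (auto simp: D_def)
    with D(1) show "ball x0 r \<subseteq> V" using r1 by (fastforce simp: D1_def)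
    have x0D: "(x0, 0) \<in> D" using r0 by (auto simp: D_def)
    then show "p \<in> \<Phi> ` D" using x0 by (force simp: \<Phi>_def)
    show "homeomorphism (ball x0 r \<times> {-r<..<r}) (\<Phi> ` D) (\<lambda>w. \<phi> (fst w) + snd w *\<^sub>R N p) \<Theta>"
      using \<Theta> unfolding D_def \<Phi>_def n_def .
    show "M \<inter> \<Phi> ` D = \<phi> ` (ball x0 r \<inter> half_plane)"
    proof (intro equalityI subsetI)
      fix y assume y: "y \<in> M \<inter> \<Phi> ` D"
      then have "y \<in> M \<inter> T" using D by auto
      then obtain v where v: "v \<in> ball x0 r1 \<inter> half_plane" "y = \<phi> v"
        unfolding T(2)[symmetric] by blast
      obtain w where w: "w \<in> D" "y = \<Phi> w" using y by auto
      have "\<Phi> (v, 0) = \<Phi> w" using v w by (simp add: \<Phi>_def)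
      then have "(v, 0) = w"
        using inj w D v by (auto simp: inj_on_def D1_def)
      with w have "v \<in> ball x0 r" by (auto simp: D_def)
      with v show "y \<in> \<phi> ` (ball x0 r \<inter> half_plane)" by blast
    next
      fix y assume "y \<in> \<phi> ` (ball x0 r \<inter> half_plane)"
      then obtain v where v: "v \<in> ball x0 r" "v \<in> half_plane" "y = \<phi> v" by auto
      then have "(v, 0) \<in> D" using r0 by (auto simp: D_def)
      moreover have "\<Phi> (v, 0) = y" using v by (simp add: \<Phi>_def)
      moreover have "v \<in> V" using v \<open>ball x0 r \<subseteq> V\<close> by blast
      then have "y \<in> M" using v lpD(3) by blast
      ultimately show "y \<in> M \<inter> \<Phi> ` D" by blast
    qed
    fix x y assume xy: "x \<in> \<Phi> ` D" "y \<in> \<Phi> ` D"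
    then have "\<Theta> x \<in> D" "\<Theta> y \<in> D" "\<Phi> (\<Theta> x) = x" "\<Phi> (\<Theta> y) = y"
      using \<Theta> by (auto simp: homeomorphism_def)
    then show "\<bar>N p \<bullet> (x - y) - (snd (\<Theta> x) - snd (\<Theta> y))\<bar> \<le> norm (x - y) / 2"
      using est(2)[of "\<Theta> x" "\<Theta> y"] D by (auto simp: n_def)
  qed
qed

section \<open>Interior and boundary of a surface\<close>

text \<open>The last coordinate of a flat chart around an interior point.  The inequality makes it
  Lipschitz and strictly monotone in all directions close to the normal, which is all that a local
  description of the two sides requires.\<close>

lemma interior_defining_function:
  assumes lp: "local_param M \<phi> V" and x0: "x0 \<in> V" "x0 $ 2 > 0" "\<phi> x0 = p"
    and N: "gauss_map M N" and U: "open U" "p \<in> U"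
  obtains r F where "r > 0" "ball p r \<subseteq> U" "continuous_on (ball p r) F"
    "\<And>x. x \<in> ball p r \<Longrightarrow> x \<in> M \<longleftrightarrow> F x = 0"
    "\<And>x y. x \<in> ball p r \<Longrightarrow> y \<in> ball p r \<Longrightarrow>
       \<bar>N p \<bullet> (x - y) - (F x - F y)\<bar> \<le> norm (x - y) / 2"
proof -
  have x0h: "x0 \<in> V \<inter> half_plane" using x0 by (auto simp: half_plane_def)
  obtain r O' \<Theta> where r: "r > 0" "r \<le> x0 $ 2" "ball x0 r \<subseteq> V" "open O'" "p \<in> O'" "O' \<subseteq> U"
    and \<Theta>: "homeomorphism (ball x0 r \<times> {-r<..<r}) O' (\<lambda>w. \<phi> (fst w) + snd w *\<^sub>R N p) \<Theta>"
    and MO: "M \<inter> O' = \<phi> ` (ball x0 r \<inter> half_plane)"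
    and est: "\<And>x y. x \<in> O' \<Longrightarrow> y \<in> O' \<Longrightarrow>
       \<bar>N p \<bullet> (x - y) - (snd (\<Theta> x) - snd (\<Theta> y))\<bar> \<le> norm (x - y) / 2"
    by (rule flat_chart[OF lp x0h x0(3) N U x0(2)]) auto
  obtain s where s: "s > 0" "ball p s \<subseteq> O'" using r by (meson openE)
  have half: "v \<in> half_plane" if "v \<in> ball x0 r" for v
    using that r(2) component_le_norm_cart[of "x0 - v" 2]
    by (auto simp: half_plane_def dist_norm)
  have iff: "x \<in> M \<longleftrightarrow> snd (\<Theta> x) = 0" if x: "x \<in> O'" for x
  proof
    assume "x \<in> M"
    then have "x \<in> \<phi> ` (ball x0 r \<inter> half_plane)" using x MO by blast
    then obtain v where v: "v \<in> ball x0 r" "x = \<phi> v" by blast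
    have "\<Theta> (\<phi> (fst (v, 0)) + snd (v, 0) *\<^sub>R N p) = (v, 0)"
      using homeomorphism_apply1[OF \<Theta>, of "(v, 0)"] v r(1) by auto
    then show "snd (\<Theta> x) = 0" using v by simp
  next
    assume 0: "snd (\<Theta> x) = 0"
    have "\<Theta> x \<in> ball x0 r \<times> {-r<..<r}" "\<phi> (fst (\<Theta> x)) + snd (\<Theta> x) *\<^sub>R N p = x"
      using \<Theta> x by (auto simp: homeomorphism_def)
    with 0 have "fst (\<Theta> x) \<in> ball x0 r" "x = \<phi> (fst (\<Theta> x))" by (auto simp: mem_Times_iff)
    with half MO show "x \<in> M" by (metis IntD1 IntI imageI)
  qed
  show thesis
  proof
    show "s > 0" "ball p s \<subseteq> U" using s r by auto
    show "continuous_on (ball p s) (\<lambda>x. snd (\<Theta> x))"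
      using \<Theta> s continuous_on_subset by (auto intro!: continuous_intros simp: homeomorphism_def)
    fix x y assume x: "x \<in> ball p s"
    show "x \<in> M \<longleftrightarrow> snd (\<Theta> x) = 0" using x s iff by blast
    assume y: "y \<in> ball p s"
    show "\<bar>N p \<bullet> (x - y) - (snd (\<Theta> x) - snd (\<Theta> y))\<bar> \<le> norm (x - y) / 2"
      by (rule est) (use x y s in blast)+
  qed
qed

text \<open>In a flat chart around a boundary point the surface is half of a horizontal section of the box.
  Its complement consists of the upper half, the lower half and the part of the box beyond the edge,
  and the third set meets the other two.\<close>

lemma boundary_complement_connected:
  assumes lp: "local_param M \<phi> V" and x0: "x0 \<in> V" "x0 $ 2 = 0" "\<phi> x0 = p"
    and N: "gauss_map M N" and U: "open U" "p \<in> U"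
  obtains O' where "open O'" "p \<in> O'" "O' \<subseteq> U" "connected (O' - M)"
proof -
  have x0h: "x0 \<in> V \<inter> half_plane" using x0 by (auto simp: half_plane_def)
  obtain r O' \<Theta> where r: "r > 0" "ball x0 r \<subseteq> V" "open O'" "p \<in> O'" "O' \<subseteq> U"
    and \<Theta>: "homeomorphism (ball x0 r \<times> {-r<..<r}) O' (\<lambda>w. \<phi> (fst w) + snd w *\<^sub>R N p) \<Theta>"
    and MO: "M \<inter> O' = \<phi> ` (ball x0 r \<inter> half_plane)"
    by (rule flat_chart[OF lp x0h x0(3) N U, of 1]) auto
  define D where "D = ball x0 r \<times> {-r<..<r}"
  define K where "K = {w \<in> D. snd w = 0 \<and> 0 \<le> fst w $ 2}"
  define \<Phi> where "\<Phi> w = \<phi> (fst w) + snd w *\<^sub>R N p" for w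
  have hom: "homeomorphism D O' \<Phi> \<Theta>" using \<Theta> by (simp add: D_def \<Phi>_def[abs_def])
  have "\<Phi> ` K = M \<inter> O'"
  proof -
    have "\<phi> ` (ball x0 r \<inter> half_plane) = \<Phi> ` K"
    proof (intro equalityI subsetI)
      fix y assume "y \<in> \<phi> ` (ball x0 r \<inter> half_plane)"
      then obtain v where "v \<in> ball x0 r" "0 \<le> v $ 2" "y = \<phi> v" by (auto simp: half_plane_def)
      then have "(v, 0) \<in> K" "y = \<Phi> (v, 0)" using r by (auto simp: K_def D_def \<Phi>_def)
      then show "y \<in> \<Phi> ` K" by blast
    next
      fix y assume "y \<in> \<Phi> ` K"
      then show "y \<in> \<phi> ` (ball x0 r \<inter> half_plane)"
        by (auto simp: K_def D_def \<Phi>_def half_plane_def)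
    qed
    then show ?thesis using MO by simp
  qed
  moreover have "inj_on \<Phi> D" "\<Phi> ` D = O'" "K \<subseteq> D"
    using hom by (auto simp: homeomorphism_def K_def intro: inj_on_inverseI)
  ultimately have im: "O' - M = \<Phi> ` (D - K)"
    by (auto simp: inj_on_image_set_diff[of \<Phi> D])
  have convD: "convex D" unfolding D_def by (intro convex_Times convex_ball) auto
  \<comment> \<open>a parameter just beyond the edge of the surface\<close>
  define e where "e = x0 - (r/2) *\<^sub>R axis 2 (1::real)"
  have e: "e \<in> ball x0 r" "e $ 2 < 0"
    using r x0 by (auto simp: e_def dist_norm)
  define A B C where "A = D \<inter> {w. snd w > 0}" and "B = D \<inter> {w. snd w < 0}"
    and "C = D \<inter> {w. fst w $ 2 < 0}"
  have lin: "linear (\<lambda>w :: (real^2) \<times> real. fst w $ 2)"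
    by (auto simp: linear_iff)
  have c: "connected A" "connected B" "connected C"
  proof -
    have "{w :: (real^2) \<times> real. snd w > 0} = snd -` {0<..}"
         "{w :: (real^2) \<times> real. snd w < 0} = snd -` {..<0}"
         "{w :: (real^2) \<times> real. fst w $ 2 < 0} = (\<lambda>w. fst w $ 2) -` {..<0}" by auto
    then have "convex A" "convex B" "convex C"
      unfolding A_def B_def C_def
      using convD lin linear_snd by (auto intro!: convex_Int convex_linear_vimage)
    then show "connected A" "connected B" "connected C" by (auto intro: convex_connected)
  qed
  have mem: "(e, r/2) \<in> A \<inter> C" "(e, -(r/2)) \<in> B \<inter> C"
    using e r by (auto simp: A_def B_def C_def D_def)
  have "connected ((A \<union> C) \<union> B)"
    by (intro connected_Un c) (use mem in auto)
  moreover have "(A \<union> C) \<union> B = D - K"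
    unfolding A_def B_def C_def K_def by (auto simp: not_less not_le)
  ultimately have "connected (D - K)" by simp
  then have "connected (\<Phi> ` (D - K))"
    by (intro connected_continuous_image continuous_on_subset[OF homeomorphism_cont1[OF hom]]) simp_all
  then have "connected (O' - M)" unfolding im .
  then show thesis by (rule that[OF r(3-5)])
qed

lemma sides_along_normal:
  fixes n p :: "'a::real_inner"
  assumes est: "\<And>x y. x \<in> ball p r \<Longrightarrow> y \<in> ball p r \<Longrightarrow>
       \<bar>n \<bullet> (x - y) - (F x - F y)\<bar> \<le> norm (x - y) / 2"
    and "norm n = 1" "F p = 0" "0 < t" "t < r"
  shows "p + t *\<^sub>R n \<in> ball p r" "p - t *\<^sub>R n \<in> ball p r" "F (p + t *\<^sub>R n) > 0" "F (p - t *\<^sub>R n) < 0"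
proof -
  have nn: "n \<bullet> n = 1" using assms(2) by (simp add: dot_square_norm)
  show b: "p + t *\<^sub>R n \<in> ball p r" "p - t *\<^sub>R n \<in> ball p r"
    using assms(2,4,5) by (simp_all add: dist_norm)
  have p: "p \<in> ball p r" using assms(4,5) by simp
  have "\<bar>t - F (p + t *\<^sub>R n)\<bar> \<le> t / 2" "\<bar>- t - F (p - t *\<^sub>R n)\<bar> \<le> t / 2"
    using est[OF b(1) p] est[OF b(2) p] assms(2-4) nn by simp_all
  then show "F (p + t *\<^sub>R n) > 0" "F (p - t *\<^sub>R n) < 0"
    using assms(4) by linarith+
qed

text \<open>A point cannot be parametrized both by a boundary point and by an interior point of the
  half-plane: small neighbourhoods of the former kind are not separated by the surface, whereas in
  the latter case the two sides are separated.\<close>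

lemma surface_boundary_iff:
  assumes lp: "local_param M \<phi> V" and x0: "x0 \<in> V \<inter> half_plane" and N: "gauss_map M N"
  shows "\<phi> x0 \<in> surface_boundary M \<longleftrightarrow> x0 $ 2 = 0"
proof
  assume "x0 $ 2 = 0"
  then show "\<phi> x0 \<in> surface_boundary M" using lp x0 by (auto simp: surface_boundary_def)
next
  assume bd: "\<phi> x0 \<in> surface_boundary M"
  define p where "p = \<phi> x0"
  have "p \<in> M" using local_paramD(3)[OF lp] x0 by (auto simp: p_def)
  note n1 = gauss_mapD(1)[OF N this]
  show "x0 $ 2 = 0"
  proof (rule ccontr)
    assume "x0 $ 2 \<noteq> 0"
    then have pos: "x0 $ 2 > 0" using x0 by (auto simp: half_plane_def)
    obtain r F where r: "r > 0" "continuous_on (ball p r) F"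
      "\<And>x. x \<in> ball p r \<Longrightarrow> x \<in> M \<longleftrightarrow> F x = 0"
      "\<And>x y. x \<in> ball p r \<Longrightarrow> y \<in> ball p r \<Longrightarrow> \<bar>N p \<bullet> (x - y) - (F x - F y)\<bar> \<le> norm (x - y) / 2"
      by (rule interior_defining_function[OF lp _ pos p_def[symmetric] N, of UNIV]) (use x0 in auto)
    obtain \<phi>' V' x' where c: "local_param M \<phi>' V'" "x' \<in> V'" "x' $ 2 = 0" "\<phi>' x' = p"
      using bd by (auto simp: surface_boundary_def p_def)
    obtain O' where O': "open O'" "p \<in> O'" "O' \<subseteq> ball p r" "connected (O' - M)"
      by (rule boundary_complement_connected[OF c N, of "ball p r"]) (use r in auto)
    obtain s where s: "s > 0" "ball p s \<subseteq> O'" using O' by (meson openE)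
    define t where "t = min (s/2) (r/2)"
    have t: "0 < t" "t < r" "t < s" using r s by (auto simp: t_def)
    have "F p = 0" using r(3)[of p] \<open>p \<in> M\<close> r by auto
    note sd = sides_along_normal[OF r(4) n1 this t(1,2)]
    have in_O: "p + t *\<^sub>R N p \<in> O'" "p - t *\<^sub>R N p \<in> O'"
      using s t n1 by (auto simp: dist_norm intro!: subsetD[OF s(2)])
    have "connected (F ` (O' - M))"
      using O' r by (intro connected_continuous_image continuous_on_subset[OF r(2)]) auto
    moreover have "F (p + t *\<^sub>R N p) \<in> F ` (O' - M)" "F (p - t *\<^sub>R N p) \<in> F ` (O' - M)"
      using in_O sd r(3) by auto
    ultimately have "0 \<in> F ` (O' - M)"
      using sd by (meson connected_iff_interval less_imp_le)
    then show False using r(3) O' by auto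
  qed
qed

lemma surface_interiorE:
  assumes "embedded_surface M" "p \<in> surface_interior M"
  obtains \<phi> V x0 where "local_param M \<phi> V" "x0 \<in> V" "x0 $ 2 > 0" "\<phi> x0 = p"
proof -
  from assms obtain \<phi> V x where *: "local_param M \<phi> V" "x \<in> V" "0 \<le> x $ 2" "\<phi> x = p"
    by (auto simp: embedded_surface_def surface_interior_def half_plane_def)
  with assms have "x $ 2 \<noteq> 0"
    by (auto simp: surface_interior_def surface_boundary_def)
  with * that show thesis by (metis less_le)
qed

text \<open>The neighbourhoods that are needed to show that removing the boundary leaves the surface connected.\<close>

lemma surface_interior_locally_connected_at:
  assumes M: "embedded_surface M" and N: "gauss_map M N" and p: "p \<in> M" and U: "open U" "p \<in> U"
  obtains O' where "open O'" "p \<in> O'" "O' \<subseteq> U" "connected (surface_interior M \<inter> O')"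
    "surface_interior M \<inter> O' \<noteq> {}"
proof -
  obtain \<phi> V x0 where lp: "local_param M \<phi> V" and x0: "x0 \<in> V \<inter> half_plane" "\<phi> x0 = p"
    using M p by (auto simp: embedded_surface_def)
  obtain r O' where r: "r > 0" "ball x0 r \<subseteq> V" "open O'" "p \<in> O'" "O' \<subseteq> U"
    and MO: "M \<inter> O' = \<phi> ` (ball x0 r \<inter> half_plane)"
    by (rule flat_chart[OF lp x0 N U, of 1]) auto
  have eq: "surface_interior M \<inter> O' = \<phi> ` (ball x0 r \<inter> {v. v $ 2 > 0})" (is "_ = \<phi> ` ?H")
  proof (intro equalityI subsetI)
    fix y assume y: "y \<in> surface_interior M \<inter> O'"
    then have "y \<in> M \<inter> O'" by (auto simp: surface_interior_def)
    then obtain v where v: "v \<in> ball x0 r \<inter> half_plane" "y = \<phi> v" using MO by auto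
    then have "v \<in> V \<inter> half_plane" using r by auto
    from surface_boundary_iff[OF lp this N] y v have "v $ 2 > 0"
      by (auto simp: surface_interior_def half_plane_def)
    with v show "y \<in> \<phi> ` ?H" by auto
  next
    fix y assume "y \<in> \<phi> ` ?H"
    then obtain v where v: "v \<in> ball x0 r" "v $ 2 > 0" "y = \<phi> v" by auto
    then have vh: "v \<in> V \<inter> half_plane" "y \<in> M \<inter> O'" using r MO by (auto simp: half_plane_def)
    then show "y \<in> surface_interior M \<inter> O'"
      using surface_boundary_iff[OF lp vh(1) N] v by (auto simp: surface_interior_def)
  qed
  have "convex {v :: real^2. v $ 2 > 0}"
    using convex_halfspace_gt[of 0 "axis 2 1 :: real^2"] by (simp add: inner_axis' inner_axis)
  then have "connected ?H" by (intro convex_connected convex_Int) auto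
  then have "connected (\<phi> ` ?H)"
    using r Ck_on_1_imp_continuous_on[OF local_paramD(2)[OF lp]]
    by (intro connected_continuous_image) (auto intro: continuous_on_subset)
  moreover have "x0 + (r/2) *\<^sub>R axis 2 1 \<in> ?H"
    using r x0 by (auto simp: dist_norm half_plane_def)
  ultimately have "connected (surface_interior M \<inter> O')" "surface_interior M \<inter> O' \<noteq> {}"
    unfolding eq by auto
  then show thesis by (rule that[OF r(3-5)])
qed

text \<open>Every point of \<open>M\<close>, also a boundary point, has arbitrarily small neighbourhoods that meet the
  interior in a nonempty connected set.  Hence a separation of the interior would extend to \<open>M\<close>.\<close>

lemma surface_interior_connected:
  assumes M: "embedded_surface M" and N: "gauss_map M N" and conn: "connected M"
  shows "connected (surface_interior M)"
proof (rule ccontr)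
  define I where "I = surface_interior M"
  assume "\<not> connected (surface_interior M)"
  then obtain A B where AB: "open A" "open B" "I \<subseteq> A \<union> B" "A \<inter> B \<inter> I = {}" "A \<inter> I \<noteq> {}" "B \<inter> I \<noteq> {}"
    unfolding connected_def I_def by auto
  have IM: "I \<subseteq> M" by (auto simp: I_def surface_interior_def)
  have loc: "\<exists>T. open T \<and> p \<in> T \<and> T \<subseteq> U \<and> connected (I \<inter> T) \<and> I \<inter> T \<noteq> {}"
    if "p \<in> M" "open U" "p \<in> U" for p U
    using surface_interior_locally_connected_at[OF M N that] unfolding I_def by metis
  define A' where "A' = \<Union>{T. open T \<and> I \<inter> T \<subseteq> A}"
  define B' where "B' = \<Union>{T. open T \<and> I \<inter> T \<subseteq> B}"
  have "open A'" "open B'" by (auto simp: A'_def B'_def)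
  moreover have "M \<subseteq> A' \<union> B'"
  proof
    fix p assume "p \<in> M"
    from loc[OF this open_UNIV] obtain T where T: "open T" "p \<in> T" "connected (I \<inter> T)" by auto
    have "A \<inter> (I \<inter> T) = {} \<or> B \<inter> (I \<inter> T) = {}"
      using T(3) AB by (intro connectedD[OF T(3) AB(1,2)]) auto
    then have "I \<inter> T \<subseteq> A \<or> I \<inter> T \<subseteq> B" using AB(3) by blast
    with T show "p \<in> A' \<union> B'" by (auto simp: A'_def B'_def)
  qed
  moreover have "A' \<inter> B' \<inter> M = {}"
  proof (rule ccontr)
    assume "A' \<inter> B' \<inter> M \<noteq> {}"
    then obtain p S T where p: "p \<in> M" "open S" "p \<in> S" "I \<inter> S \<subseteq> A" "open T" "p \<in> T" "I \<inter> T \<subseteq> B"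
      by (auto simp: A'_def B'_def)
    from loc[of p "S \<inter> T"] p obtain W where "W \<subseteq> S \<inter> T" "I \<inter> W \<noteq> {}" by blast
    with p AB show False by blast
  qed
  moreover have "A \<inter> I \<subseteq> A'" "B \<inter> I \<subseteq> B'" using AB by (auto simp: A'_def B'_def)
  ultimately have "A' \<inter> M = {} \<or> B' \<inter> M = {}" "A \<inter> I \<subseteq> A' \<inter> M" "B \<inter> I \<subseteq> B' \<inter> M"
    using connectedD[OF conn] IM by blast+
  then show False using AB(5,6) by blast
qed

section \<open>Maxima of functions on a surface\<close>

lemma orthonormal_triple_expansion:
  fixes e1 e2 n X :: "real^3"
  assumes "norm e1 = 1" "norm e2 = 1" "norm n = 1" "e1 \<bullet> e2 = 0" "n \<bullet> e1 = 0" "n \<bullet> e2 = 0"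
  shows "X = (X \<bullet> e1) *\<^sub>R e1 + (X \<bullet> e2) *\<^sub>R e2 + (X \<bullet> n) *\<^sub>R n"
proof -
  define S where "S = {e1, e2, n}"
  have self: "e1 \<bullet> e1 = 1" "e2 \<bullet> e2 = 1" "n \<bullet> n = 1"
    using assms by (simp_all add: dot_square_norm)
  have dist: "e1 \<noteq> e2" "n \<noteq> e1" "n \<noteq> e2" using self assms by auto
  have "pairwise orthogonal S"
    using assms by (auto simp: S_def pairwise_def orthogonal_def inner_commute)
  moreover have "0 \<notin> S" using assms by (auto simp: S_def)
  ultimately have "independent S" by (rule pairwise_orthogonal_independent)
  moreover have "card S = 3" using dist by (auto simp: S_def)
  ultimately have "(UNIV :: (real^3) set) \<subseteq> span S"
    by (intro card_ge_dim_independent) (auto simp: dim_UNIV)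
  then have span: "y \<in> span S" for y by auto
  define d where "d = X - ((X \<bullet> e1) *\<^sub>R e1 + (X \<bullet> e2) *\<^sub>R e2 + (X \<bullet> n) *\<^sub>R n)"
  have "orthogonal d y" if "y \<in> S" for y
    using that assms self
    by (auto simp: S_def d_def orthogonal_def inner_diff_left inner_add_left inner_commute[of e2 e1]
        inner_commute[of e1 n] inner_commute[of e2 n])
  then have "orthogonal d d" using orthogonal_to_span[OF span] by blast
  then show ?thesis by (simp add: d_def orthogonal_def)
qed

text \<open>Being interior enters here: the curve through the point stays in the surface for negative as
  well as for positive times, so that it can detect a maximum.\<close>

lemma curve_through_tangent_vector:
  assumes p: "p \<in> surface_interior M" and v: "v \<in> tangent_plane M p"
  obtains \<gamma> \<gamma>' d where "d > (0::real)" "\<gamma> 0 = p" "\<gamma>' 0 = v" "isCont \<gamma>' 0"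
    "\<And>t. \<bar>t\<bar> < d \<Longrightarrow> \<gamma> t \<in> M"
    "\<And>t. \<bar>t\<bar> < d \<Longrightarrow> (\<gamma> has_vector_derivative \<gamma>' t) (at t)"
    "\<And>t. \<bar>t\<bar> < d \<Longrightarrow> \<gamma>' t \<in> tangent_plane M (\<gamma> t)"
proof -
  obtain \<phi> V x w where lp: "local_param M \<phi> V" and x: "x \<in> V" "x \<in> half_plane" "\<phi> x = p"
    and w: "v = frechet_derivative \<phi> (at x) w"
    using v by (auto simp: tangent_plane_def)
  note lpD = local_paramD[OF lp]
  have "x $ 2 > 0"
    using p x lp by (force simp: surface_interior_def surface_boundary_def half_plane_def)
  define W where "W = V \<inter> {v. v $ 2 > 0}"
  have "open W" unfolding W_def
    by (intro open_Int lpD open_Collect_less continuous_intros)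
  moreover have "x \<in> W" using x \<open>x $ 2 > 0\<close> by (auto simp: W_def)
  moreover have line: "isCont (\<lambda>t::real. x + t *\<^sub>R w) t" for t by (intro continuous_intros)
  ultimately have "eventually (\<lambda>t::real. x + t *\<^sub>R w \<in> W) (at 0)"
    using line[of 0] unfolding isCont_def by (auto dest!: topological_tendstoD[of _ _ _ W])
  then obtain d where d: "d > 0" "\<And>t. t \<noteq> 0 \<Longrightarrow> \<bar>t\<bar> < d \<Longrightarrow> x + t *\<^sub>R w \<in> W"
    unfolding eventually_at by (auto simp: dist_real_def)
  then have dW: "x + t *\<^sub>R w \<in> W" if "\<bar>t\<bar> < d" for t
    using that \<open>x \<in> W\<close> by (cases "t = 0") auto
  have WV: "y \<in> V \<inter> half_plane" if "y \<in> W" for y using that by (auto simp: W_def half_plane_def)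
  define \<gamma> where "\<gamma> t = \<phi> (x + t *\<^sub>R w)" for t :: real
  define \<gamma>' where "\<gamma>' t = frechet_derivative \<phi> (at (x + t *\<^sub>R w)) w" for t :: real
  show thesis
  proof
    show "d > 0" "\<gamma> 0 = p" "\<gamma>' 0 = v" using d x w by (auto simp: \<gamma>_def \<gamma>'_def)
    have "isCont (\<lambda>y. frechet_derivative \<phi> (at y) w) (x + 0 *\<^sub>R w)"
      using Ck_on_1_continuous_directional_derivative[OF lpD(2)] lpD(1) x
      by (auto simp: continuous_on_eq_continuous_at)
    from isCont_o2[OF line this] show "isCont \<gamma>' 0" unfolding \<gamma>'_def .
    fix t :: real assume t: "\<bar>t\<bar> < d"
    have tV: "x + t *\<^sub>R w \<in> V \<inter> half_plane" using dW[OF t] WV by blast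
    show "\<gamma> t \<in> M" using tV lpD(3) by (auto simp: \<gamma>_def)
    show "\<gamma>' t \<in> tangent_plane M (\<gamma> t)"
      unfolding \<gamma>_def \<gamma>'_def by (rule tangent_planeI[OF lp tV])
    have D: "(\<phi> has_derivative frechet_derivative \<phi> (at (x + t *\<^sub>R w))) (at (x + t *\<^sub>R w))"
      using lpD(4) tV by auto
    have "((\<lambda>t. x + t *\<^sub>R w) has_derivative (\<lambda>h. h *\<^sub>R w)) (at t)"
      by (auto intro!: derivative_eq_intros)
    from has_derivative_compose[OF this D]
    have "(\<gamma> has_derivative (\<lambda>h. frechet_derivative \<phi> (at (x + t *\<^sub>R w)) (h *\<^sub>R w))) (at t)"
      by (simp add: \<gamma>_def[abs_def])
    then show "(\<gamma> has_vector_derivative \<gamma>' t) (at t)"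
      using linear_cmul[OF has_derivative_linear[OF D]]
      by (simp add: has_vector_derivative_def \<gamma>'_def)
  qed
qed

lemma eventually_along_curve:
  fixes \<gamma> :: "real \<Rightarrow> 'a::metric_space"
  assumes "isCont \<gamma> 0" "d > 0" "\<And>t. \<bar>t\<bar> < d \<Longrightarrow> \<gamma> t \<in> M"
    and ev: "\<forall>\<^sub>F y in at (\<gamma> 0) within M. \<psi> y \<le> (\<psi> (\<gamma> 0) :: real)"
  obtains d' where "d' > 0" "d' \<le> d" "\<And>t. \<bar>t\<bar> < d' \<Longrightarrow> \<psi> (\<gamma> t) \<le> \<psi> (\<gamma> 0)"
proof -
  obtain e where e: "e > 0" "\<And>y. y \<in> M \<Longrightarrow> dist y (\<gamma> 0) < e \<Longrightarrow> \<psi> y \<le> \<psi> (\<gamma> 0)"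
    using ev unfolding eventually_at by (metis order_refl)
  obtain s where s: "s > 0" "\<And>t. \<bar>t\<bar> < s \<Longrightarrow> dist (\<gamma> t) (\<gamma> 0) < e"
    using assms(1) e(1) unfolding continuous_at_eps_delta dist_real_def by (metis diff_zero)
  show thesis
    by (rule that[of "min d s"]) (use assms s e in auto)
qed

lemma tangential_derivative_at_max:
  assumes p: "p \<in> surface_interior M" and v: "v \<in> tangent_plane M p"
    and der: "(\<psi> has_derivative \<psi>') (at p)"
    and max: "\<forall>\<^sub>F y in at p within M. \<psi> y \<le> \<psi> p"
  shows "\<psi>' v = (0::real)"
proof -
  obtain \<gamma> \<gamma>' d where g: "d > (0::real)" "\<gamma> 0 = p" "\<gamma>' 0 = v" "\<And>t. \<bar>t\<bar> < d \<Longrightarrow> \<gamma> t \<in> M"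
    "\<And>t. \<bar>t\<bar> < d \<Longrightarrow> (\<gamma> has_vector_derivative \<gamma>' t) (at t)"
    by (rule curve_through_tangent_vector[OF p v]) metis
  have g0: "(\<gamma> has_derivative (\<lambda>h. h *\<^sub>R v)) (at 0)"
    using g(5)[of 0] g(1,3) by (simp add: has_vector_derivative_def)
  obtain d' where d': "d' > 0" "\<And>t. \<bar>t\<bar> < d' \<Longrightarrow> \<psi> (\<gamma> t) \<le> \<psi> (\<gamma> 0)"
    by (rule eventually_along_curve[of \<gamma> d M \<psi>])
       (use g max has_derivative_continuous[OF g0] in auto)
  have "((\<lambda>t. \<psi> (\<gamma> t)) has_derivative (\<lambda>h. \<psi>' (h *\<^sub>R v))) (at 0)"
    by (rule has_derivative_compose[OF g0]) (use der g in simp)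
  then have "((\<lambda>t. \<psi> (\<gamma> t)) has_real_derivative \<psi>' v) (at 0)"
    using linear_cmul[OF has_derivative_linear[OF der]]
    by (simp add: has_field_derivative_def mult.commute[of _ "\<psi>' v"])
  then show ?thesis
    by (rule DERIV_local_max[OF _ d'(1)]) (use d' in auto)
qed

text \<open>At a maximum of \<open>\<psi>\<close> on \<open>M\<close> the field \<open>grad \<psi> - \<mu> N\<close> vanishes, and along a curve in
  \<open>M\<close> its product with the velocity is the derivative of \<open>\<psi>\<close>.  Hence the second derivative of
  \<open>\<psi>\<close> along the curve exists at the maximum and involves only the first derivative of the
  curve.\<close>

lemma second_order_condition_at_max:
  assumes N: "gauss_map M N" and p: "p \<in> surface_interior M" and v: "v \<in> tangent_plane M p"
    and DN: "(N has_derivative D) (at p within M)"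
    and grad: "\<And>x. (\<psi> has_derivative (\<lambda>h. G x \<bullet> h)) (at x)"
    and hess: "(G has_derivative G') (at p)" and G: "G p = \<mu> *\<^sub>R N p"
    and max: "\<forall>\<^sub>F y in at p within M. \<psi> y \<le> \<psi> p"
  shows "G' v \<bullet> v \<le> \<mu> * (D v \<bullet> v)"
proof (rule ccontr)
  assume neg: "\<not> ?thesis"
  obtain \<gamma> \<gamma>' d where g: "d > (0::real)" "\<gamma> 0 = p" "\<gamma>' 0 = v" "isCont \<gamma>' 0"
    "\<And>t. \<bar>t\<bar> < d \<Longrightarrow> \<gamma> t \<in> M"
    "\<And>t. \<bar>t\<bar> < d \<Longrightarrow> (\<gamma> has_vector_derivative \<gamma>' t) (at t)"
    "\<And>t. \<bar>t\<bar> < d \<Longrightarrow> \<gamma>' t \<in> tangent_plane M (\<gamma> t)"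
    by (rule curve_through_tangent_vector[OF p v]) metis
  have g0: "(\<gamma> has_derivative (\<lambda>h. h *\<^sub>R v)) (at 0)"
    using g(6)[of 0] g(1,3) by (simp add: has_vector_derivative_def)
  obtain d' where d': "d' > 0" "d' \<le> d" "\<And>t. \<bar>t\<bar> < d' \<Longrightarrow> \<psi> (\<gamma> t) \<le> \<psi> (\<gamma> 0)"
    by (rule eventually_along_curve[of \<gamma> d M \<psi>])
       (use g max has_derivative_continuous[OF g0] in auto)
  define E where "E t = G (\<gamma> t) - \<mu> *\<^sub>R N (\<gamma> t)" for t
  define L where "L = G' v - \<mu> *\<^sub>R D v"
  define du where "du t = E t \<bullet> \<gamma>' t" for t
  have u: "((\<lambda>t. \<psi> (\<gamma> t)) has_real_derivative du t) (at t)" if t: "\<bar>t\<bar> < d" for t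
  proof -
    have "((\<lambda>t. \<psi> (\<gamma> t)) has_derivative (\<lambda>h. G (\<gamma> t) \<bullet> (h *\<^sub>R \<gamma>' t))) (at t)"
      using has_derivative_compose[OF g(6)[OF t, unfolded has_vector_derivative_def] grad] .
    moreover have "N (\<gamma> t) \<bullet> \<gamma>' t = 0"
      using gauss_mapD(3)[OF N g(5)[OF t] g(7)[OF t]] .
    ultimately show ?thesis
      by (simp add: has_field_derivative_def du_def E_def inner_diff_left mult.commute[of _ "G (\<gamma> t) \<bullet> \<gamma>' t"])
  qed
  have E0: "E 0 = 0" using G g by (simp add: E_def)
  have "((\<lambda>t. N (\<gamma> t)) has_derivative (\<lambda>h. D (h *\<^sub>R v))) (at 0 within {t. \<bar>t\<bar> < d})"
    by (rule has_derivative_in_compose[where g = N and f = \<gamma>])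
       (use g DN has_derivative_at_withinI[OF g0] has_derivative_subset[OF DN, of "\<gamma> ` {t. \<bar>t\<bar> < d}"] in auto)
  moreover have "at 0 within {t::real. \<bar>t\<bar> < d} = at 0"
  proof (rule at_within_open)
    have "{t::real. \<bar>t\<bar> < d} = {-d<..<d}" by auto
    then show "open {t::real. \<bar>t\<bar> < d}" by simp
  qed (use g in simp)
  ultimately have DNg: "((\<lambda>t. N (\<gamma> t)) has_derivative (\<lambda>h. D (h *\<^sub>R v))) (at 0)" by simp
  have "((\<lambda>t. G (\<gamma> t)) has_derivative (\<lambda>h. G' (h *\<^sub>R v))) (at 0)"
    by (rule has_derivative_compose[OF g0]) (use hess g in simp)
  then have "(E has_derivative (\<lambda>h. G' (h *\<^sub>R v) - \<mu> *\<^sub>R D (h *\<^sub>R v))) (at 0)"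
    unfolding E_def[abs_def] using DNg by (auto intro!: derivative_intros)
  then have "(E has_derivative (\<lambda>h. h *\<^sub>R L)) (at 0)"
    using linear_cmul[OF has_derivative_linear[OF hess]] linear_cmul[OF has_derivative_linear[OF DN]]
    by (simp add: L_def scaleR_diff_right mult.commute)
  then have "((\<lambda>t. norm (E t - t *\<^sub>R L) / norm t) \<longlongrightarrow> 0) (at 0)"
    using E0 by (simp add: has_derivative_at)
  then have "((\<lambda>t. norm (E t /\<^sub>R t - L)) \<longlongrightarrow> 0) (at 0)"
  proof (rule Lim_transform_eventually)
    have "norm (E t - t *\<^sub>R L) / norm t = norm (E t /\<^sub>R t - L)" if "t \<noteq> 0" for t
    proof -
      have "E t /\<^sub>R t - L = (E t - t *\<^sub>R L) /\<^sub>R t" using that by (simp add: scaleR_diff_right)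
      then show ?thesis by (simp add: divide_inverse_commute)
    qed
    then show "\<forall>\<^sub>F t in at 0. norm (E t - t *\<^sub>R L) / norm t = norm (E t /\<^sub>R t - L)"
      by (auto simp: eventually_at_filter)
  qed
  then have "((\<lambda>t. E t /\<^sub>R t) \<longlongrightarrow> L) (at 0)"
    by (simp add: tendsto_norm_zero_iff LIM_zero_iff)
  then have "((\<lambda>t. (E t /\<^sub>R t) \<bullet> \<gamma>' t) \<longlongrightarrow> L \<bullet> v) (at 0)"
    using g(3,4) by (intro tendsto_inner) (auto simp: isCont_def)
  then have "(du has_real_derivative (L \<bullet> v)) (at 0)"
    using E0 by (simp add: DERIV_def du_def divide_inverse_commute)
  moreover have "L \<bullet> v > 0" using neg by (simp add: L_def inner_diff_left)
  ultimately obtain s where s: "s > 0" "\<And>h. h > 0 \<Longrightarrow> h < s \<Longrightarrow> du 0 < du (0 + h)"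
    using DERIV_pos_inc_right by blast
  define t where "t = min s d' / 2"
  have t: "t > 0" "t < s" "t < d'" using s d' by (auto simp: t_def)
  have "\<psi> (\<gamma> 0) < \<psi> (\<gamma> t)"
  proof (rule DERIV_pos_imp_increasing_open[OF t(1)])
    fix x assume x: "0 < x" "x < t"
    then show "\<exists>y. ((\<lambda>t. \<psi> (\<gamma> t)) has_real_derivative y) (at x) \<and> 0 < y"
      using u[of x] s(2)[of x] t d' E0 by (intro exI[of _ "du x"]) (auto simp: du_def)
  next
    show "continuous_on {0..t} (\<lambda>t. \<psi> (\<gamma> t))"
      using u t d' by (intro continuous_at_imp_continuous_on ballI DERIV_isCont[OF u]) auto
  qed
  with d'(3)[of t] t show False by auto
qed

text \<open>The principal directions are two orthonormal vectors in the tangent plane, so only multiples of the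
  normal are orthogonal to both.\<close>

lemma gradient_normal_at_max:
  assumes N: "gauss_map M N" and p: "p \<in> surface_interior M"
    and H: "has_mean_curvature M N p h"
    and grad: "(\<psi> has_derivative (\<lambda>h. g \<bullet> h)) (at p)"
    and max: "\<forall>\<^sub>F y in at p within M. \<psi> y \<le> \<psi> p"
  obtains \<mu> where "g = \<mu> *\<^sub>R N p"
proof -
  have pM: "p \<in> M" using p by (auto simp: surface_interior_def)
  obtain e1 e2 where e: "e1 \<in> tangent_plane M p" "e2 \<in> tangent_plane M p"
    "norm e1 = 1" "norm e2 = 1" "e1 \<bullet> e2 = 0"
    using H by (auto simp: has_mean_curvature_def principal_curvatures_def)
  note n = gauss_mapD[OF N pM]
  have "g \<bullet> e1 = 0" "g \<bullet> e2 = 0"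
    using tangential_derivative_at_max[OF p _ grad max] e by auto
  then have "g = (g \<bullet> N p) *\<^sub>R N p"
    using orthonormal_triple_expansion[OF e(3,4) n(1) e(5) n(3)[OF e(1)] n(3)[OF e(2)], of g] by simp
  then show thesis by (rule that)
qed

text \<open>Apply the second order condition to the principal directions and add.  The directions are
  eigenvectors of the derivative of the normal, so the right-hand sides add up to a multiple of the
  mean curvature; the left-hand sides give the trace of the Hessian on the tangent plane.\<close>

lemma mean_curvature_inequality_at_max:
  assumes N: "gauss_map M N" and p: "p \<in> surface_interior M"
    and H: "has_mean_curvature M N p h"
    and grad: "\<And>x. (\<psi> has_derivative (\<lambda>h. G x \<bullet> h)) (at x)"
    and hess: "(G has_derivative G') (at p)"
    and max: "\<forall>\<^sub>F y in at p within M. \<psi> y \<le> \<psi> p"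
  obtains \<mu> e1 e2 where "G p = \<mu> *\<^sub>R N p"
    "norm e1 = 1" "norm e2 = 1" "e1 \<bullet> e2 = 0" "N p \<bullet> e1 = 0" "N p \<bullet> e2 = 0"
    "G' e1 \<bullet> e1 + G' e2 \<bullet> e2 + 2 * \<mu> * h \<le> 0"
proof -
  have pM: "p \<in> M" using p by (auto simp: surface_interior_def)
  obtain \<kappa>1 \<kappa>2 D e1 e2 where D: "(N has_derivative D) (at p within M)" and
    e: "e1 \<in> tangent_plane M p" "e2 \<in> tangent_plane M p"
    "norm e1 = 1" "norm e2 = 1" "e1 \<bullet> e2 = 0" and
    k: "- D e1 = \<kappa>1 *\<^sub>R e1" "- D e2 = \<kappa>2 *\<^sub>R e2" "h = (\<kappa>1 + \<kappa>2) / 2"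
    using H unfolding has_mean_curvature_def principal_curvatures_def by blast
  obtain \<mu> where \<mu>: "G p = \<mu> *\<^sub>R N p" by (rule gradient_normal_at_max[OF N p H grad max])
  have "G' v \<bullet> v \<le> \<mu> * (D v \<bullet> v)" if "v \<in> tangent_plane M p" for v
    by (rule second_order_condition_at_max[OF N p that D grad hess \<mu> max])
  from this[OF e(1)] this[OF e(2)]
  have "G' e1 \<bullet> e1 \<le> \<mu> * (D e1 \<bullet> e1)" "G' e2 \<bullet> e2 \<le> \<mu> * (D e2 \<bullet> e2)" .
  moreover have "D e1 = (-\<kappa>1) *\<^sub>R e1" "D e2 = (-\<kappa>2) *\<^sub>R e2"
    using k by (metis minus_minus scaleR_minus_left)+
  then have "D e1 \<bullet> e1 = - \<kappa>1" "D e2 \<bullet> e2 = - \<kappa>2"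
    using e by (simp_all add: dot_square_norm)
  ultimately have "G' e1 \<bullet> e1 + G' e2 \<bullet> e2 + 2 * \<mu> * h \<le> 0"
    using k(3) by (simp add: algebra_simps)
  with \<mu> e gauss_mapD(3)[OF N pM] that show thesis by blast
qed

text \<open>The computation behind the maximum principle, at a maximum \<open>x\<close> of the height in direction \<open>e\<close>
  plus a small Gaussian.  Here \<open>X\<close> is the position relative to the centre of the Gaussian, \<open>- q X\<close> is
  the gradient of the Gaussian and \<open>n\<close> is the normal at \<open>x\<close>.  The condition on the gradient forces
  \<open>n\<close> to be within \<open>2 q |X|\<close> of \<open>\<nu>\<close>, so by the Lipschitz condition the curvature is \<open>O(q)\<close> with a
  constant that does not depend on \<open>\<alpha>\<close>.  The trace of the Hessian is at least \<open>q (\<alpha> R\<^sup>2 - 2)\<close>, because \<open>X\<close> is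
  nearly tangential.  The value of \<open>\<alpha>\<close> makes the latter dominate.\<close>

lemma barrier_contradiction:
  fixes e1 e2 n \<nu> e X :: "real^3"
  assumes on: "norm e1 = 1" "norm e2 = 1" "norm n = 1" "e1 \<bullet> e2 = 0" "n \<bullet> e1 = 0" "n \<bullet> e2 = 0"
    and \<nu>: "norm \<nu> = 1" "e = s *\<^sub>R \<nu>" "s = 1 \<or> s = -1" "norm (n - \<nu>) \<le> 1/4"
    and R: "R > 0" "7 * R / 8 \<le> norm X" "norm X \<le> 9 * R / 8" "\<bar>e \<bullet> X\<bar> \<le> R / 8"
    and q: "q > 0" "q * norm X \<le> 1/4"
    and grad: "e - q *\<^sub>R X = \<mu> *\<^sub>R n"
    and hh: "\<bar>hh\<bar> \<le> K * norm (n - \<nu>)" "K \<ge> 0"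
    and \<alpha>: "\<alpha> > 0" "\<alpha> * R\<^sup>2 = 3 + 9 * K * R"
    and ineq: "q * (2 * \<alpha> * ((X \<bullet> e1)\<^sup>2 + (X \<bullet> e2)\<^sup>2) - 2) + 2 * \<mu> * hh \<le> 0"
  shows False
proof -
  have nn: "n \<bullet> n = 1" "\<nu> \<bullet> \<nu> = 1" using on \<nu> by (simp_all add: dot_square_norm)
  have ss: "s * s = 1" "\<bar>s\<bar> = 1" using \<nu> by auto
  define x where "x = norm X"
  have x: "x > 0" "7 * R / 8 \<le> x" "x \<le> 9 * R / 8" using R by (auto simp: x_def)
  have "x\<^sup>2 = (X \<bullet> e1)\<^sup>2 + (X \<bullet> e2)\<^sup>2 + (X \<bullet> n)\<^sup>2"
  proof -
    have "X \<bullet> X = X \<bullet> ((X \<bullet> e1) *\<^sub>R e1 + (X \<bullet> e2) *\<^sub>R e2 + (X \<bullet> n) *\<^sub>R n)"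
      using orthonormal_triple_expansion[OF on, of X] by metis
    then show ?thesis unfolding x_def power2_norm_eq_inner
      by (simp add: inner_add_right power2_eq_square)
  qed
  moreover have Xn: "\<bar>X \<bullet> n\<bar> \<le> x / 2"
  proof -
    have "X \<bullet> \<nu> = s * (e \<bullet> X)" using \<nu>(2) ss by (simp add: inner_commute)
    then have "\<bar>X \<bullet> \<nu>\<bar> \<le> R / 8" using R(4) ss by (simp add: abs_mult)
    moreover have "\<bar>X \<bullet> (n - \<nu>)\<bar> \<le> x * (1/4)"
      unfolding x_def using Cauchy_Schwarz_ineq2[of X "n - \<nu>"] \<nu>(4)
      by (meson mult_left_mono norm_ge_zero order_trans)
    moreover have "X \<bullet> n = X \<bullet> (n - \<nu>) + X \<bullet> \<nu>" by (simp add: inner_diff_right)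
    ultimately show ?thesis using x by linarith
  qed
  moreover have "(X \<bullet> n)\<^sup>2 \<le> (x / 2)\<^sup>2" using Xn power2_le_iff_abs_le[of "x/2" "X \<bullet> n"] x by simp
  ultimately have 1: "(X \<bullet> e1)\<^sup>2 + (X \<bullet> e2)\<^sup>2 \<ge> 3/4 * x\<^sup>2" by (simp add: power_divide)
  have "(7 * R / 8)\<^sup>2 \<le> x\<^sup>2" using x R by (intro power_mono) auto
  then have "49 * R\<^sup>2 \<le> 64 * x\<^sup>2" by (simp add: power_mult_distrib power_divide)
  then have "3/4 * x\<^sup>2 \<ge> R\<^sup>2 / 2" using zero_le_power2[of R] by linarith
  with 1 have sq: "(X \<bullet> e1)\<^sup>2 + (X \<bullet> e2)\<^sup>2 \<ge> R\<^sup>2 / 2" by linarith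
  have "norm (\<mu> *\<^sub>R n) = \<bar>\<mu>\<bar>" using on by simp
  then have mu: "\<bar>\<mu>\<bar> = norm (e - q *\<^sub>R X)" using grad by simp
  have ne: "norm e = 1" using \<nu> ss by simp
  have qx: "norm (q *\<^sub>R X) = q * x" using q by (simp add: x_def)
  have mu1: "\<bar>\<bar>\<mu>\<bar> - 1\<bar> \<le> q * x"
    using norm_triangle_ineq3[of "e - q *\<^sub>R X" e] mu ne qx by simp
  have "s * \<mu> > 0"
  proof -
    have "\<mu> = (e - q *\<^sub>R X) \<bullet> n" using grad nn by simp
    then have "s * \<mu> = \<nu> \<bullet> n - s * q * (X \<bullet> n)"
      using \<nu>(2,3) by (auto simp: inner_diff_left algebra_simps)
    moreover have "\<nu> \<bullet> n \<ge> 3/4"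
      using Cauchy_Schwarz_ineq2[of \<nu> "n - \<nu>"] \<nu> nn by (simp add: inner_diff_right)
    moreover have "\<bar>s * q * (X \<bullet> n)\<bar> \<le> 1/8"
    proof -
      have "\<bar>s * q * (X \<bullet> n)\<bar> = q * \<bar>X \<bullet> n\<bar>" using ss q by (simp add: abs_mult)
      also have "\<dots> \<le> q * (x / 2)" using Xn q by (intro mult_left_mono) auto
      finally show ?thesis using q by (simp add: x_def)
    qed
    ultimately show ?thesis by linarith
  qed
  then have smu: "s * \<mu> = \<bar>\<mu>\<bar>" using ss by (metis abs_mult abs_of_pos mult_1)
  have "n - \<nu> = (1 - s * \<mu>) *\<^sub>R n - (s * q) *\<^sub>R X"
  proof -
    have "\<nu> = s *\<^sub>R e" using \<nu>(2) ss by simp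
    also have "e = \<mu> *\<^sub>R n + q *\<^sub>R X" using grad by (simp add: algebra_simps)
    finally show ?thesis by (simp add: algebra_simps)
  qed
  then have "norm (n - \<nu>) \<le> norm ((1 - s * \<mu>) *\<^sub>R n) + norm ((s * q) *\<^sub>R X)"
    by (metis norm_triangle_ineq4)
  also have "\<dots> \<le> 2 * (q * x)"
    using mu1 on ss q unfolding smu by (simp add: abs_mult x_def)
  finally have nd: "norm (n - \<nu>) \<le> 2 * (q * x)" .
  have "\<bar>hh\<bar> \<le> K * (2 * (q * x))"
    using hh nd by (meson mult_left_mono order_trans)
  also have "\<dots> \<le> K * (2 * (q * (9 * R / 8)))"
    using x hh q by (intro mult_left_mono) auto
  finally have "\<bar>hh\<bar> \<le> 9/4 * (K * q * R)" by (simp add: mult_ac)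
  moreover have "\<bar>\<mu>\<bar> \<le> 2" using mu1 q by (simp add: x_def)
  ultimately have "\<bar>\<mu>\<bar> * \<bar>hh\<bar> \<le> 2 * (9/4 * (K * q * R))" by (intro mult_mono) auto
  then have "\<bar>2 * \<mu> * hh\<bar> \<le> 9 * (K * q * R)" by (simp add: abs_mult mult_ac)
  moreover have "q * (2 * \<alpha> * ((X \<bullet> e1)\<^sup>2 + (X \<bullet> e2)\<^sup>2) - 2) \<ge> q * (2 * \<alpha> * (R\<^sup>2 / 2) - 2)"
    using q \<alpha> sq by (intro mult_left_mono diff_right_mono) auto
  moreover have "q * (2 * \<alpha> * (R\<^sup>2 / 2) - 2) = q + 9 * (K * q * R)"
    using \<alpha>(2) by (simp add: algebra_simps)
  ultimately show False using ineq q by linarith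
qed

section \<open>The touching principle for planes\<close>

lemma gaussian_barrier_derivatives:
  fixes e X0 :: "'a::euclidean_space"
  shows "((\<lambda>x. e \<bullet> x + \<epsilon> * exp (- \<alpha> * ((x - X0) \<bullet> (x - X0)))) has_derivative
      (\<lambda>h. (e - (2 * \<alpha> * \<epsilon> * exp (- \<alpha> * ((x - X0) \<bullet> (x - X0)))) *\<^sub>R (x - X0)) \<bullet> h)) (at x)"
    and "((\<lambda>x. e - (2 * \<alpha> * \<epsilon> * exp (- \<alpha> * ((x - X0) \<bullet> (x - X0)))) *\<^sub>R (x - X0)) has_derivative
      (\<lambda>v. (2 * \<alpha> * \<epsilon> * exp (- \<alpha> * ((x - X0) \<bullet> (x - X0)))) *\<^sub>R
             ((2 * \<alpha> * ((x - X0) \<bullet> v)) *\<^sub>R (x - X0) - v))) (at x)"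
  by (rule has_derivative_eq_rhs, (rule derivative_intros | simp)+,
      auto simp: fun_eq_iff inner_commute algebra_simps)+

lemma normal_at_touching_point:
  assumes N: "gauss_map M N" and p: "p \<in> surface_interior M"
    and H: "has_mean_curvature M N p h" and e: "norm e = 1"
    and max: "\<And>x. x \<in> M \<Longrightarrow> e \<bullet> x \<le> e \<bullet> p"
  shows "N p = e \<or> N p = - e"
proof -
  have "((\<lambda>x. e \<bullet> x) has_derivative (\<lambda>h. e \<bullet> h)) (at p)"
    by (auto intro!: derivative_eq_intros)
  then obtain \<mu> where \<mu>: "e = \<mu> *\<^sub>R N p"
    by (rule gradient_normal_at_max[OF N p H]) (use max in \<open>auto simp: eventually_at_filter\<close>)
  have "norm (N p) = 1" using gauss_mapD(1)[OF N] p by (auto simp: surface_interior_def)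
  then have "\<bar>\<mu>\<bar> = 1" using e by (subst (asm) \<mu>) simp
  then show ?thesis using \<mu> by (auto simp: abs_if split: if_splits)
qed

text \<open>A set that keeps distance \<open>|x0 - y|\<close> from \<open>x0\<close> meets the ball with diameter from \<open>x0\<close> to \<open>y\<close> at most in
  \<open>y\<close>, by the parallelogram law.\<close>

lemma cball_half_touches:
  fixes x0 y a :: "'a::real_inner"
  assumes "norm (a - (x0 + y) /\<^sub>R 2) \<le> norm (x0 - y) / 2" "norm (a - x0) \<ge> norm (x0 - y)"
  shows "a = y"
proof -
  define b d where "b = a - (x0 + y) /\<^sub>R 2" and "d = (x0 - y) /\<^sub>R 2"
  have nd: "norm d = norm (x0 - y) / 2" by (simp add: d_def)
  have eq: "b - d = a - x0" "b + d = a - y"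
    by (simp_all add: b_def d_def algebra_simps flip: scaleR_add_left)
  have "(norm (b + d))\<^sup>2 + (norm (b - d))\<^sup>2 = 2 * (norm b)\<^sup>2 + 2 * (norm d)\<^sup>2"
    by (simp add: power2_norm_eq_inner inner_add_left inner_add_right inner_diff_left inner_diff_right)
  moreover have "(norm b)\<^sup>2 \<le> (norm d)\<^sup>2" using assms nd by (intro power_mono) (auto simp: b_def)
  moreover have "(2 * norm d)\<^sup>2 \<le> (norm (a - x0))\<^sup>2" using assms nd by (intro power_mono) auto
  then have "4 * (norm d)\<^sup>2 \<le> (norm (b - d))\<^sup>2" by (simp add: eq power_mult_distrib)
  ultimately have "(norm (b + d))\<^sup>2 \<le> 0" by linarith
  then show ?thesis by (simp add: eq)
qed

text \<open>Let \<open>A\<close> be the set where the surface touches the plane with the given orientation.  Near a point of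
  \<open>A\<close> the surface is a graph over the plane, so a surface point off \<open>A\<close> projects to a point
  of the plane off \<open>A\<close>; around that projection there is a ball that meets \<open>A\<close> in a single point
  \<open>y\<close> of its boundary sphere.  Adding to the height a small multiple of a Gaussian centred in that ball
  moves the maximum to a nearby point where the gradient is almost vertical, and a steep Gaussian
  contradicts the inequality for the mean curvature there.\<close>

lemma touching_set_open:
  assumes M: "compact M" "embedded_surface M" and N: "gauss_map M N"
    and bd: "closed (surface_boundary M)"
    and H: "\<And>p. p \<in> surface_interior M \<Longrightarrow> has_mean_curvature M N p (\<H> (N p))"
    and \<nu>: "norm \<nu> = 1" "e = s *\<^sub>R \<nu>" "s = 1 \<or> s = -1"
    and lip: "K \<ge> 0" "\<rho> > 0" "\<And>n. norm n = 1 \<Longrightarrow> norm (n - \<nu>) < \<rho> \<Longrightarrow> \<bar>\<H> n\<bar> \<le> K * norm (n - \<nu>)"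
    and le: "\<And>x. x \<in> M \<Longrightarrow> e \<bullet> x \<le> c"
    and int: "\<And>x. x \<in> M \<Longrightarrow> e \<bullet> x = c \<Longrightarrow> x \<in> surface_interior M"
    and y0: "y0 \<in> M" "e \<bullet> y0 = c" "N y0 = \<nu>"
  obtains r where "r > 0" "\<And>x. x \<in> M \<Longrightarrow> dist x y0 < r \<Longrightarrow> e \<bullet> x = c \<and> N x = \<nu>"
proof -
  define A where "A = {x \<in> M. e \<bullet> x = c \<and> N x = \<nu>}"
  have ne: "norm e = 1" using \<nu> by auto
  then have ee: "e \<bullet> e = 1" by (simp add: dot_square_norm)
  have closedM: "closed M" using M by (simp add: compact_imp_closed)
  have contN: "continuous_on M N" using N by (simp add: gauss_map_def)
  have normN: "norm (N x) = 1" if "x \<in> M" for x using gauss_mapD(1)[OF N that] .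
  have normal: "N x = e \<or> N x = - e" if "x \<in> M" "e \<bullet> x = c" for x
    using normal_at_touching_point[OF N int[OF that] H[OF int[OF that]] ne] le that by auto
  have ve: "e = \<nu> \<or> e = - \<nu>" using \<nu> by auto
  have near: "N x = \<nu>" if "x \<in> M" "e \<bullet> x = c" "norm (N x - \<nu>) < 1" for x
  proof (rule ccontr)
    assume "N x \<noteq> \<nu>"
    then have "N x = - \<nu>" using normal[OF that(1,2)] ve by auto
    then have "norm (N x - \<nu>) = norm (2 *\<^sub>R \<nu>)" by (metis norm_minus_cancel minus_diff_eq diff_minus_eq_add scaleR_2)
    then show False using \<nu> that by simp
  qed
  have y0i: "y0 \<in> surface_interior M" using int y0 by auto
  obtain \<phi> V x' where ch: "local_param M \<phi> V" "x' \<in> V" "x' $ 2 > 0" "\<phi> x' = y0"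
    by (rule surface_interiorE[OF M(2) y0i])
  obtain r1 F where r1: "r1 > 0" "\<And>x. x \<in> ball y0 r1 \<Longrightarrow> x \<in> M \<longleftrightarrow> F x = 0"
    "\<And>x y. x \<in> ball y0 r1 \<Longrightarrow> y \<in> ball y0 r1 \<Longrightarrow> \<bar>N y0 \<bullet> (x - y) - (F x - F y)\<bar> \<le> norm (x - y) / 2"
    by (rule interior_defining_function[OF ch N open_UNIV]) auto
  define \<tau> where "\<tau> = min \<rho> (1/4)"
  have "\<tau> > 0" using lip by (auto simp: \<tau>_def)
  then obtain r2 where r2: "r2 > 0" "\<And>x. x \<in> M \<Longrightarrow> dist x y0 < r2 \<Longrightarrow> dist (N x) \<nu> < \<tau>"
    using contN y0 unfolding continuous_on_iff by metis
  have "open (- surface_boundary M)" "y0 \<in> - surface_boundary M"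
    using bd y0i by (auto simp: surface_interior_def)
  then obtain r3 where r3: "r3 > 0" "ball y0 r3 \<subseteq> - surface_boundary M" by (meson openE)
  define r where "r = min r1 (min r2 r3)"
  have r: "r > 0" "r \<le> r1" "r \<le> r2" "r \<le> r3" using r1 r2 r3 by (auto simp: r_def)
  have rint: "x \<in> surface_interior M" if "x \<in> M" "dist x y0 < r" for x
  proof -
    have "x \<in> ball y0 r3" using that(2) r by (simp add: dist_commute)
    then show ?thesis using r3(2) that(1) by (auto simp: surface_interior_def)
  qed
  have rN: "norm (N x - \<nu>) < \<tau>" if "x \<in> M" "dist x y0 < r" for x
    using r2(2)[OF that(1)] that r by (simp add: dist_norm)
  have rA: "x \<in> A" if "x \<in> M" "dist x y0 < r" "e \<bullet> x = c" for x
    using near[OF that(1,3)] rN[OF that(1,2)] that by (auto simp: A_def \<tau>_def)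
  have "x1 \<in> A" if x1: "x1 \<in> M" "dist x1 y0 < r / 8" for x1
  proof (rule ccontr)
    assume "x1 \<notin> A"
    then have lt: "e \<bullet> x1 < c" using rA[OF x1(1)] x1 le[OF x1(1)] r by force
    \<comment> \<open>the projection of x1 to the touched plane; it is not in A, since A is a graph near y0\<close>
    define x0 where "x0 = x1 + (c - e \<bullet> x1) *\<^sub>R e"
    have x0: "e \<bullet> x0 = c" using ee by (simp add: x0_def inner_add_right)
    have d01: "norm (x0 - x1) = c - e \<bullet> x1" using lt ne by (simp add: x0_def)
    also have "\<dots> = e \<bullet> (y0 - x1)" using y0 by (simp add: inner_diff_right)
    also have "\<dots> \<le> norm (y0 - x1)" using norm_cauchy_schwarz[of e "y0 - x1"] ne by simp
    finally have "dist x0 x1 < r / 8" using x1 by (simp add: dist_norm norm_minus_commute)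
    then have x0y0: "dist x0 y0 < r / 4" using x1 dist_triangle[of x0 y0 x1] by linarith
    have "x0 \<notin> A"
    proof
      assume "x0 \<in> A"
      then have "F x0 = 0" "F x1 = 0" and b: "x0 \<in> ball y0 r1" "x1 \<in> ball y0 r1"
        using r1(2) x0y0 x1 r by (auto simp: A_def dist_commute)
      then have "\<bar>\<nu> \<bullet> (x0 - x1)\<bar> \<le> norm (x0 - x1) / 2" using r1(3)[OF b] y0 by simp
      moreover have "x0 - x1 = (c - e \<bullet> x1) *\<^sub>R e" by (simp add: x0_def)
      then have "\<bar>\<nu> \<bullet> (x0 - x1)\<bar> = c - e \<bullet> x1"
        using \<nu> lt by (auto simp: dot_square_norm)
      ultimately show False using d01 lt by simp
    qed
    have "compact A"
    proof -
      have "A = M \<inter> {x. e \<bullet> x = c} \<inter> (M \<inter> N -` {\<nu>})" by (auto simp: A_def)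
      moreover have "closed (M \<inter> N -` {\<nu>})"
        using continuous_closed_preimage[OF contN closedM] by auto
      ultimately show ?thesis
        using M closed_hyperplane[of e c] by (auto intro!: compact_Int_closed)
    qed
    moreover have y0A: "y0 \<in> A" using y0 by (simp add: A_def)
    ultimately obtain y where y: "y \<in> A" "\<And>a. a \<in> A \<Longrightarrow> dist x0 y \<le> dist x0 a"
      using distance_attains_inf[of A x0] compact_imp_closed by blast
    \<comment> \<open>Halving the ball makes \<open>y\<close> its only point in \<open>A\<close>.\<close>
    define R where "R = dist x0 y / 2"
    define X0 where "X0 = (x0 + y) /\<^sub>R 2"
    have "R > 0" using \<open>x0 \<notin> A\<close> y by (auto simp: R_def)
    have yy0: "dist y y0 < r / 2"
      using y(2)[OF y0A] x0y0 dist_triangle[of y y0 x0] by (simp add: dist_commute)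
    have yprop: "y \<in> M" "e \<bullet> y = c" "N y = \<nu>" using y by (auto simp: A_def)
    have eX0: "e \<bullet> X0 = c" using x0 yprop by (simp add: X0_def inner_add_right)
    have yX0: "norm (y - X0) = R"
    proof -
      have "y - X0 = (y - x0) /\<^sub>R 2" 
        by (simp add: X0_def scaleR_right_diff_distrib scaleR_add_right)
      then show ?thesis by (simp add: R_def dist_norm norm_minus_commute)
    qed
    have touch: "a = y" if "a \<in> A" "norm (a - X0) \<le> R" for a
      using cball_half_touches[of a x0 y] y(2)[OF that(1)] that(2)
      by (simp add: R_def X0_def dist_norm norm_minus_commute)
    define \<delta> where "\<delta> = min (R / 8) (r / 4)"
    have \<delta>: "\<delta> > 0" "\<delta> \<le> R / 8" "\<delta> \<le> r / 4" using \<open>R > 0\<close> r by (auto simp: \<delta>_def)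
    have ball_r: "dist x y0 < r" if "dist y x \<le> \<delta>" for x
      using that yy0 \<delta> r dist_triangle[of x y0 y] by (simp add: dist_commute)
    \<comment> \<open>Outside the ball around \<open>X0\<close> the Gaussian is below its value at \<open>y\<close>; inside it, the height is
      bounded away from \<open>c\<close> on the sphere around \<open>y\<close>.\<close>
    define S where "S = M \<inter> sphere y \<delta> \<inter> cball X0 R"
    have "compact S" unfolding S_def using M by (intro compact_Int_closed) auto
    have Slt: "e \<bullet> x < c" if "x \<in> S" for x
    proof (rule ccontr)
      assume "\<not> e \<bullet> x < c"
      moreover have xS: "x \<in> M" "dist y x = \<delta>" "norm (x - X0) \<le> R"
        using that by (auto simp: S_def dist_norm norm_minus_commute)
      ultimately have "x \<in> A" using rA[of x] ball_r[of x] le[of x] by auto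
      then have "x = y" using touch xS by auto
      then show False using xS \<delta> by auto
    qed
    obtain \<eta> where \<eta>: "\<eta> > 0" "\<And>x. x \<in> S \<Longrightarrow> e \<bullet> x \<le> c - \<eta>"
    proof (cases "S = {}")
      case False
      have "continuous_on S (\<lambda>x. e \<bullet> x)" by (intro continuous_intros)
      from continuous_attains_sup[OF \<open>compact S\<close> False this]
      obtain m where "m \<in> S" "\<And>x. x \<in> S \<Longrightarrow> e \<bullet> x \<le> e \<bullet> m" by blast
      then show thesis using Slt[of m] that[of "c - e \<bullet> m"] by auto
    qed (use that[of 1] in auto)
    \<comment> \<open>steep enough for the contradiction at the end\<close>
    define \<alpha> where "\<alpha> = (3 + 9 * K * R) / R\<^sup>2"
    have \<alpha>: "\<alpha> > 0" "\<alpha> * R\<^sup>2 = 3 + 9 * K * R"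
      using \<open>R > 0\<close> lip(1) by (auto simp: \<alpha>_def intro!: divide_pos_pos add_pos_nonneg)
    \<comment> \<open>small enough to keep the maximum off the sphere around y, and the gradient nearly vertical\<close>
    define \<epsilon> where "\<epsilon> = min (\<eta> / 2) (1 / (16 * \<alpha> * R))"
    have \<epsilon>: "\<epsilon> > 0" "\<epsilon> < \<eta>" "\<epsilon> * (16 * \<alpha> * R) \<le> 1"
    proof -
      have "16 * \<alpha> * R > 0" using \<alpha> \<open>R > 0\<close> by simp
      moreover have "\<epsilon> \<le> 1 / (16 * \<alpha> * R)" by (simp add: \<epsilon>_def)
      ultimately show "\<epsilon> * (16 * \<alpha> * R) \<le> 1" by (simp add: pos_le_divide_eq)
      show "\<epsilon> > 0" "\<epsilon> < \<eta>" using \<eta> \<open>16 * \<alpha> * R > 0\<close> by (auto simp: \<epsilon>_def)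
    qed
    define h where "h x = exp (- \<alpha> * ((x - X0) \<bullet> (x - X0)))" for x
    define \<psi> where "\<psi> x = e \<bullet> x + \<epsilon> * h x" for x
    have h_norm: "h x = exp (- \<alpha> * (norm (x - X0))\<^sup>2)" for x by (simp add: h_def power2_norm_eq_inner)
    have h1: "h x \<le> 1" "h x > 0" for x using \<alpha> by (auto simp: h_norm)
    have hy: "h y = exp (- \<alpha> * R\<^sup>2)" by (simp add: h_norm yX0)
    have cont: "continuous_on (M \<inter> cball y \<delta>) \<psi>"
      unfolding \<psi>_def h_def by (intro continuous_intros)
    have "compact (M \<inter> cball y \<delta>)" "y \<in> M \<inter> cball y \<delta>"
      using M \<delta> yprop by (auto intro: compact_Int_closed)
    then have "\<exists>x\<in>M \<inter> cball y \<delta>. \<forall>z\<in>M \<inter> cball y \<delta>. \<psi> z \<le> \<psi> x"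
      using continuous_attains_sup[OF _ _ cont] by blast
    then obtain x where x: "x \<in> M" "dist y x \<le> \<delta>"
      and xmax: "\<And>z. z \<in> M \<Longrightarrow> dist y z \<le> \<delta> \<Longrightarrow> \<psi> z \<le> \<psi> x"
      by auto
    have "\<psi> y \<le> \<psi> x" using xmax[of y] yprop \<delta> by auto
    then have ge: "c + \<epsilon> * h y \<le> e \<bullet> x + \<epsilon> * h x" by (simp add: \<psi>_def yprop)
    have "dist y x < \<delta>"
    proof (rule ccontr)
      assume "\<not> dist y x < \<delta>"
      then have dx: "dist y x = \<delta>" using x by simp
      show False
      proof (cases "norm (x - X0) \<le> R")
        case True
        then have "x \<in> S" using dx x by (auto simp: S_def dist_norm norm_minus_commute)
        then have "e \<bullet> x \<le> c - \<eta>" using \<eta> by blast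
        moreover have "\<epsilon> * h x \<le> \<epsilon>" "\<epsilon> * h y > 0" using h1 \<epsilon> by (auto simp: mult_le_cancel_left2)
        ultimately show False using ge \<epsilon> by linarith
      next
        case False
        then have "R\<^sup>2 < (norm (x - X0))\<^sup>2" using \<open>R > 0\<close> by (intro power_strict_mono) auto
        then have "h x < h y" using \<alpha>(1) by (simp add: hy h_norm[of x])
        then show False using ge le[OF x(1)] \<epsilon> by (smt (verit) mult_strict_left_mono)
      qed
    qed
    have max: "\<forall>\<^sub>F z in at x within M. \<psi> z \<le> \<psi> x"
    unfolding eventually_at_topological using \<open>dist y x < \<delta>\<close> xmax
      by (intro exI[of _ "ball y \<delta>"]) auto
    have xi: "x \<in> surface_interior M" using rint x ball_r by auto
    define q where "q = 2 * \<alpha> * \<epsilon> * h x"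
    define X where "X = x - X0"
    obtain \<mu> e1 e2 where m: "e - q *\<^sub>R X = \<mu> *\<^sub>R N x"
      "norm e1 = 1" "norm e2 = 1" "e1 \<bullet> e2 = 0" "N x \<bullet> e1 = 0" "N x \<bullet> e2 = 0"
      "(q *\<^sub>R ((2 * \<alpha> * (X \<bullet> e1)) *\<^sub>R X - e1)) \<bullet> e1 + (q *\<^sub>R ((2 * \<alpha> * (X \<bullet> e2)) *\<^sub>R X - e2)) \<bullet> e2
         + 2 * \<mu> * \<H> (N x) \<le> 0"
      unfolding q_def X_def h_def
      by (rule mean_curvature_inequality_at_max[OF N xi H[OF xi] _ _ max[unfolded \<psi>_def h_def]])
         (rule gaussian_barrier_derivatives | assumption)+
    have normX: "\<bar>norm X - R\<bar> \<le> R / 8"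
    proof -
      have "\<bar>norm (x - X0) - norm (y - X0)\<bar> \<le> norm ((x - X0) - (y - X0))" by (rule norm_triangle_ineq3)
      also have "\<dots> \<le> \<delta>" using x by (simp add: dist_norm norm_minus_commute)
      finally show ?thesis using yX0 \<delta> by (simp add: X_def)
    qed
    have "e \<bullet> X = e \<bullet> (x - y)" using eX0 yprop by (simp add: X_def inner_diff_right)
    moreover have "\<bar>e \<bullet> (x - y)\<bar> \<le> norm (x - y)" using Cauchy_Schwarz_ineq2[of e "x - y"] ne by simp
    ultimately have eX: "\<bar>e \<bullet> X\<bar> \<le> R / 8" using x \<delta> by (simp add: dist_norm norm_minus_commute)
    have q: "q > 0" "q * norm X \<le> 1/4"
    proof -
      show "q > 0" using \<alpha> \<epsilon> h1 by (simp add: q_def)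
      have "norm X \<le> 2 * R" using normX \<open>R > 0\<close> by linarith
      then have "q * norm X \<le> (2 * \<alpha> * \<epsilon> * 1) * (2 * R)"
        unfolding q_def using \<alpha>(1) \<epsilon>(1) h1[of x] \<open>R > 0\<close> by (intro mult_mono) auto
      also have "\<dots> \<le> 1/4" using \<epsilon>(3) by (simp add: algebra_simps)
      finally show "q * norm X \<le> 1/4" .
    qed
    have nx: "norm (N x - \<nu>) < \<tau>" using rN x ball_r by auto
    show False
    proof (rule barrier_contradiction[OF m(2,3) normN[OF x(1)] m(4-6) \<nu> _ \<open>R > 0\<close> _ _ eX q m(1) _ lip(1) \<alpha>])
      show "norm (N x - \<nu>) \<le> 1/4" using nx by (simp add: \<tau>_def)
      show "7 * R / 8 \<le> norm X" "norm X \<le> 9 * R / 8" using normX by linarith+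
      show "\<bar>\<H> (N x)\<bar> \<le> K * norm (N x - \<nu>)"
        using lip(3)[OF normN[OF x(1)]] nx by (auto simp: \<tau>_def)
      show "q * (2 * \<alpha> * ((X \<bullet> e1)\<^sup>2 + (X \<bullet> e2)\<^sup>2) - 2) + 2 * \<mu> * \<H> (N x) \<le> 0"
        using m(7) m(2,3) by (simp add: inner_diff_left dot_square_norm power2_eq_square algebra_simps)
    qed
  qed
  then show thesis using that[of "r / 8"] r by (auto simp: A_def)
qed

lemma touching_plane_principle:
  assumes M: "compact M" "embedded_surface M" "connected M" and N: "gauss_map M N"
    and bd: "closed (surface_boundary M)"
    and H: "\<And>p. p \<in> surface_interior M \<Longrightarrow> has_mean_curvature M N p (\<H> (N p))"
    and \<nu>: "norm \<nu> = 1" "e = s *\<^sub>R \<nu>" "s = 1 \<or> s = -1"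
    and lip: "K \<ge> 0" "\<rho> > 0" "\<And>n. norm n = 1 \<Longrightarrow> norm (n - \<nu>) < \<rho> \<Longrightarrow> \<bar>\<H> n\<bar> \<le> K * norm (n - \<nu>)"
    and le: "\<And>x. x \<in> M \<Longrightarrow> e \<bullet> x \<le> c"
    and int: "\<And>x. x \<in> M \<Longrightarrow> e \<bullet> x = c \<Longrightarrow> x \<in> surface_interior M"
    and y0: "y0 \<in> M" "e \<bullet> y0 = c" "N y0 = \<nu>" and x: "x \<in> M"
  shows "e \<bullet> x = c"
proof -
  define A where "A = {x \<in> M. e \<bullet> x = c \<and> N x = \<nu>}"
  have contN: "continuous_on M N" using N by (simp add: gauss_map_def)
  have "openin (top_of_set M) A"
    unfolding openin_euclidean_subtopology_iff
  proof (intro conjI ballI)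
    show "A \<subseteq> M" by (auto simp: A_def)
    fix y assume "y \<in> A"
    then have y: "y \<in> M" "e \<bullet> y = c" "N y = \<nu>" by (auto simp: A_def)
    obtain r where "r > 0" "\<And>x. x \<in> M \<Longrightarrow> dist x y < r \<Longrightarrow> e \<bullet> x = c \<and> N x = \<nu>"
      using touching_set_open[OF M(1,2) N bd H \<nu> lip le int y] by metis
    then show "\<exists>r>0. \<forall>x'\<in>M. dist x' y < r \<longrightarrow> x' \<in> A" by (auto simp: A_def)
  qed
  moreover have "closedin (top_of_set M) A"
  proof -
    have "A = (M \<inter> {x. e \<bullet> x = c}) \<inter> (M \<inter> N -` {\<nu>})" by (auto simp: A_def)
    moreover have "closedin (top_of_set M) (M \<inter> N -` {\<nu>})"
      by (rule continuous_closedin_preimage[OF contN]) simp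
    moreover have "closedin (top_of_set M) (M \<inter> {x. e \<bullet> x = c})"
      using closed_hyperplane[of e c] by (rule closedin_closed_Int)
    ultimately show ?thesis by (metis closedin_Int)
  qed
  moreover have "A \<noteq> {}" using y0 by (auto simp: A_def)
  ultimately have "A = M" using M(3) by (auto simp: connected_clopen)
  then show ?thesis using x by (auto simp: A_def)
qed

section \<open>Jordan domains in a plane\<close>

lemma plane_coordinates:
  fixes a :: "real^3"
  assumes "a \<noteq> 0"
  obtains J :: "complex \<Rightarrow> real^3" and L :: "real^3 \<Rightarrow> complex"
  where "continuous_on UNIV J" "continuous_on UNIV L" "range J \<subseteq> {x. a \<bullet> x = b}" "\<forall>c. L (J c) = c"
    "\<forall>x. a \<bullet> x = b \<longrightarrow> J (L x) = x"
proof -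
  define n where "n = a /\<^sub>R norm a"
  have n: "norm n = 1" "a = norm a *\<^sub>R n" using assms by (simp_all add: n_def)
  obtain u' :: "real^3" where u': "u' \<noteq> 0" "orthogonal n u'"
    by (rule orthogonal_to_vector_exists[of n]) auto
  define u where "u = u' /\<^sub>R norm u'"
  have u: "norm u = 1" "n \<bullet> u = 0" using u' by (simp_all add: u_def orthogonal_def)
  define w where "w = cross3 n u"
  have w: "u \<bullet> w = 0" "n \<bullet> w = 0" by (simp_all add: w_def dot_cross_self)
  have "(norm w)\<^sup>2 = 1" using norm_cross[of n u] n u by (simp add: w_def)
  then have w1: "norm w = 1" using power2_eq_1_iff[of "norm w"] norm_ge_zero[of w] by linarith
  have self: "n \<bullet> n = 1" "u \<bullet> u = 1" "w \<bullet> w = 1" using n u w1 by (simp_all add: dot_square_norm)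
  define J where "J c = (b / norm a) *\<^sub>R n + Re c *\<^sub>R u + Im c *\<^sub>R w" for c
  define L where "L x = Complex (u \<bullet> x) (w \<bullet> x)" for x
  have nx: "n \<bullet> x = (a \<bullet> x) / norm a" for x using assms by (subst n(2)) simp
  show thesis
  proof
    show "continuous_on UNIV J" unfolding J_def by (intro continuous_intros)
    show "continuous_on UNIV L" unfolding L_def Complex_eq by (intro continuous_intros)
    have "a \<bullet> J c = b" for c
    proof -
      have "a \<bullet> J c = norm a * (n \<bullet> J c)" by (metis n(2) inner_scaleR_left)
      also have "\<dots> = b" using assms u w self by (simp add: J_def inner_add_right)
      finally show ?thesis .
    qed
    then show "range J \<subseteq> {x. a \<bullet> x = b}" by auto
    have "L (J c) = c" for c
      using u w self by (simp add: J_def L_def inner_add_right inner_commute[of u n] inner_commute[of w n]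
          inner_commute[of w u])
    then show "\<forall>c. L (J c) = c" by simp
    have "J (L x) = x" if "a \<bullet> x = b" for x
      using orthonormal_triple_expansion[OF u(1) w1 n(1) w(1) u(2) w(2), of x] nx[of x] that
      by (simp add: J_def L_def inner_commute algebra_simps)
    then show "\<forall>x. a \<bullet> x = b \<longrightarrow> J (L x) = x" by simp
  qed
qed

text \<open>Transfer to the complex plane by affine coordinates.  A bounded connected open set whose frontier is
  a Jordan curve is a component of the complement of that curve, hence the inside, and its exterior is
  the outside.\<close>

lemma Jordan_plane_domain:
  assumes a: "a \<noteq> 0" and P: "P = {x :: real^3. a \<bullet> x = b}"
    and \<Gamma>: "\<Gamma> \<subseteq> P" "simple_closed_curve \<Gamma>" and \<Omega>: "bounds_domain_in P \<Gamma> \<Omega>"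
  shows "connected (P - closure \<Omega>)" "connected \<Omega>" "closure \<Omega> = \<Omega> \<union> \<Gamma>" "\<Omega> \<inter> \<Gamma> = {}" "\<Omega> \<subseteq> P"
    "bounded \<Omega>" "\<Gamma> \<noteq> {}" "closed \<Gamma>"
proof -
  have closedP: "closed P" by (simp add: P closed_hyperplane)
  have op: "openin (top_of_set P) \<Omega>" and fr: "(top_of_set P) frontier_of \<Omega> = \<Gamma>"
    using \<Omega> by (auto simp: bounds_domain_in_def)
  show conn: "connected \<Omega>" and bdd: "bounded \<Omega>" using \<Omega> by (auto simp: bounds_domain_in_def)
  show sub: "\<Omega> \<subseteq> P" using op openin_imp_subset by blast
  have clP: "closure \<Omega> \<subseteq> P" using sub closedP closure_minimal by blast
  have "(top_of_set P) closure_of \<Omega> = closure \<Omega>"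
    using sub clP by (simp add: closure_of_subtopology Int_absorb1)
  then have fr': "\<Gamma> = closure \<Omega> - \<Omega>" using fr frontier_of_openin[OF op] by simp
  then show cl: "closure \<Omega> = \<Omega> \<union> \<Gamma>" and disj: "\<Omega> \<inter> \<Gamma> = {}" using closure_subset by auto
  obtain \<gamma> where \<gamma>: "simple_path \<gamma>" "pathfinish \<gamma> = pathstart \<gamma>" "path_image \<gamma> = \<Gamma>"
    using \<Gamma> by (auto simp: simple_closed_curve_def)
  show ne: "\<Gamma> \<noteq> {}" "closed \<Gamma>" using \<gamma> closed_path_image simple_path_imp_path by auto
  obtain J :: "complex \<Rightarrow> real^3" and L :: "real^3 \<Rightarrow> complex" where JL: "continuous_on UNIV J" "continuous_on UNIV L" "range J \<subseteq> {x. a \<bullet> x = b}"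
    "\<forall>c. L (J c) = c" "\<forall>x. a \<bullet> x = b \<longrightarrow> J (L x) = x"
    by (rule plane_coordinates[OF a, of b])
  have JP: "J c \<in> P" for c using JL P by auto
  have JLP: "J (L x) = x" if "x \<in> P" for x using JL P that by auto
  define c where "c = L \<circ> \<gamma>"
  have "inj_on L P" using JLP by (rule inj_on_inverseI)
  then have "simple_path c"
    unfolding c_def using \<gamma> \<Gamma> JL(2)
    by (intro simple_path_continuous_image) (auto intro: continuous_on_subset inj_on_subset)
  moreover have "pathfinish c = pathstart c" using \<gamma> by (simp add: c_def pathfinish_compose pathstart_compose)
  ultimately obtain inner outer where io:
    "inner \<noteq> {}" "open inner" "connected inner" "outer \<noteq> {}" "open outer" "connected outer"
    "bounded inner" "\<not> bounded outer" "inner \<inter> outer = {}" "inner \<union> outer = - path_image c"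
    "frontier inner = path_image c" "frontier outer = path_image c"
    by (rule Jordan_curve)
  have pc: "path_image c = L ` \<Gamma>" using \<gamma> by (simp add: c_def path_image_compose)
  define \<Omega>' where "\<Omega>' = J -` \<Omega>"
  have L\<Omega>: "\<Omega>' = L ` \<Omega>"
  proof (intro equalityI subsetI)
    fix z assume "z \<in> \<Omega>'"
    then have "J z \<in> \<Omega>" "z = L (J z)" using JL(4) by (auto simp: \<Omega>'_def)
    then show "z \<in> L ` \<Omega>" by blast
  next
    fix z assume "z \<in> L ` \<Omega>"
    then obtain x where x: "x \<in> \<Omega>" "z = L x" by blast
    then have "J z = x" using JLP sub by blast
    then show "z \<in> \<Omega>'" using x by (simp add: \<Omega>'_def)
  qed
  obtain T where T: "open T" "\<Omega> = P \<inter> T" using op by (auto simp: openin_open)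
  have "\<Omega>' = J -` T" using T JP by (auto simp: \<Omega>'_def)
  then have open': "open \<Omega>'" using JL(1) T by (simp add: continuous_on_open_vimage)
  have clim: "closure \<Omega>' = L ` closure \<Omega>"
  proof
    have "compact (closure \<Omega>)" using bdd by (simp add: compact_closure)
    then have "closed (L ` closure \<Omega>)"
      using JL(2) by (intro compact_imp_closed compact_continuous_image) (auto intro: continuous_on_subset)
    then show "closure \<Omega>' \<subseteq> L ` closure \<Omega>"
      unfolding L\<Omega> using closure_subset by (intro closure_minimal) auto
    show "L ` closure \<Omega> \<subseteq> closure \<Omega>'"
      unfolding L\<Omega>
      by (rule image_closure_subset[OF continuous_on_subset[OF JL(2)]]) (auto intro: subsetD[OF closure_subset])
  qed
  have fr'': "frontier \<Omega>' = path_image c"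
  proof -
    have "frontier \<Omega>' = closure \<Omega>' - \<Omega>'" using open' by (simp add: frontier_def interior_open)
    also have "\<dots> = L ` closure \<Omega> - L ` \<Omega>" using clim L\<Omega> by simp
    also have "\<dots> = L ` (closure \<Omega> - \<Omega>)"
      using inj_on_image_set_diff[OF \<open>inj_on L P\<close>, of "closure \<Omega>" \<Omega>] clP sub by auto
    finally show ?thesis using fr' pc by simp
  qed
  have conn': "connected \<Omega>'"
    unfolding L\<Omega> using JL(2) conn by (intro connected_continuous_image) (auto intro: continuous_on_subset)
  have bdd': "bounded \<Omega>'"
  proof -
    have "compact (L ` closure \<Omega>)" using bdd JL(2)
      by (intro compact_continuous_image) (auto intro: continuous_on_subset simp: compact_closure)
    then show ?thesis unfolding L\<Omega>
      by (rule bounded_subset[OF compact_imp_bounded image_mono[OF closure_subset]])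
  qed
  have ne': "\<Omega>' \<noteq> {}" using ne(1) fr' by (auto simp: L\<Omega>)
  have disj': "\<Omega>' \<inter> path_image c = {}" using frontier_disjoint_eq[of \<Omega>'] fr'' open' by (simp add: Int_commute)
  have full: "C \<subseteq> \<Omega>'" if "connected C" "C \<inter> path_image c = {}" "C \<inter> \<Omega>' \<noteq> {}" for C
    using connected_Int_frontier[OF that(1,3)] that(2) fr'' by auto
  have "\<not> outer \<subseteq> \<Omega>'" using bdd' io bounded_subset by blast
  then have "outer \<inter> \<Omega>' = {}" using full[OF io(6)] io(10) by blast
  then have sub': "\<Omega>' \<subseteq> inner" using io(10) disj' by blast
  then have "inner \<subseteq> \<Omega>'" using full[OF io(3)] io(10) ne' by blast
  with sub' have eq: "\<Omega>' = inner" by auto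
  have "P - closure \<Omega> = J ` outer"
  proof (intro equalityI subsetI)
    fix x assume x: "x \<in> P - closure \<Omega>"
    then have "L x \<notin> L ` closure \<Omega>" using \<open>inj_on L P\<close> clP by (auto simp: inj_on_def)
    then have "L x \<in> outer" using clim eq io(10,11) closure_Un_frontier[of inner] by blast
    then show "x \<in> J ` outer" using JLP x by force
  next
    fix x assume "x \<in> J ` outer"
    then obtain z where z: "z \<in> outer" "x = J z" by auto
    have "x \<notin> closure \<Omega>"
    proof
      assume "x \<in> closure \<Omega>"
      moreover have "z = L x" using z JL(4) by simp
      ultimately have "z \<in> closure \<Omega>'" unfolding clim by blast
      then show False using z eq io(9,10,11) closure_Un_frontier[of inner] by blast
    qed
    then show "x \<in> P - closure \<Omega>" using z JP by auto
  qed
  then show "connected (P - closure \<Omega>)"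
    using io(6) JL(1) by (auto intro!: connected_continuous_image intro: continuous_on_subset)
qed

section \<open>The two sides of a surface\<close>

text \<open>For \<open>x\<close> near the surface this is the side of the surface on which \<open>x\<close> lies; the nearest
  point need not be unique, and the value does not depend on its choice.\<close>

definition side :: "(real^3) set \<Rightarrow> (real^3 \<Rightarrow> real^3) \<Rightarrow> real^3 \<Rightarrow> real" where
  "side M N x = (if N (closest_point M x) \<bullet> (x - closest_point M x) > 0 then 1 else -1)"

lemma side_cases: "side M N x = 1 \<or> side M N x = -1"
  by (simp add: side_def)

text \<open>A nearest point is a maximum on the surface of the negative squared distance, whose gradient there
  is twice the connecting vector.\<close>

lemma nearest_point_along_normal:
  assumes N: "gauss_map M N" and y: "y \<in> surface_interior M"
    and H: "has_mean_curvature M N y h"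
    and near: "\<And>z. z \<in> M \<Longrightarrow> dist x y \<le> dist x z"
  obtains t where "x - y = t *\<^sub>R N y"
proof -
  have "((\<lambda>z. - ((z - x) \<bullet> (z - x))) has_derivative (\<lambda>h. (2 *\<^sub>R (x - y)) \<bullet> h)) (at y)"
    by (rule has_derivative_eq_rhs, (rule derivative_intros)+) (auto simp: fun_eq_iff inner_commute algebra_simps)
  then obtain \<mu> where "2 *\<^sub>R (x - y) = \<mu> *\<^sub>R N y"
  proof (rule gradient_normal_at_max[OF N y H])
    have "- ((z - x) \<bullet> (z - x)) \<le> - ((y - x) \<bullet> (y - x))" if "z \<in> M" for z
    proof -
      have "norm (y - x) \<le> norm (z - x)"
        using near[OF that] by (simp add: dist_norm norm_minus_commute)
      then show ?thesis unfolding norm_le by simp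
    qed
    then show "\<forall>\<^sub>F z in at y within M. - ((z - x) \<bullet> (z - x)) \<le> - ((y - x) \<bullet> (y - x))"
      by (auto simp: eventually_at_filter)
  qed
  then have "(1/2) *\<^sub>R (2 *\<^sub>R (x - y)) = (1/2) *\<^sub>R (\<mu> *\<^sub>R N y)" by simp
  then show thesis by (intro that[of "\<mu> / 2"]) simp
qed

text \<open>A nearest point \<open>y\<close> of \<open>x\<close> differs from \<open>x\<close> by a multiple of the normal at \<open>y\<close>, which near \<open>m\<close> is
  close to the normal at \<open>m\<close>.  The defining function vanishes at \<open>y\<close> and is monotone in such
  directions, so its sign at \<open>x\<close> is the sign of the multiple.\<close>

lemma side_local:
  assumes M: "compact M" "embedded_surface M" and N: "gauss_map M N"
    and bd: "closed (surface_boundary M)"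
    and H: "\<And>p. p \<in> surface_interior M \<Longrightarrow> has_mean_curvature M N p (h p)"
    and m: "m \<in> surface_interior M"
  obtains r F where "r > 0" "ball m r \<inter> surface_boundary M = {}" "continuous_on (ball m r) F"
    "\<And>x. x \<in> ball m r \<Longrightarrow> x \<in> M \<longleftrightarrow> F x = 0"
    "\<And>x. x \<in> ball m r - M \<Longrightarrow> side M N x = sgn (F x)"
    "\<And>t. 0 < t \<Longrightarrow> t < r \<Longrightarrow> F (m + t *\<^sub>R N m) > 0 \<and> F (m - t *\<^sub>R N m) < 0"
proof -
  have mM: "m \<in> M" using m by (auto simp: surface_interior_def)
  have closedM: "closed M" using M by (simp add: compact_imp_closed)
  obtain \<phi> V x' where ch: "local_param M \<phi> V" "x' \<in> V" "x' $ 2 > 0" "\<phi> x' = m"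
    by (rule surface_interiorE[OF M(2) m])
  have "open (- surface_boundary M)" "m \<in> - surface_boundary M"
    using bd m by (auto simp: surface_interior_def)
  then obtain r1 F where r1: "r1 > 0" "ball m r1 \<subseteq> - surface_boundary M" "continuous_on (ball m r1) F"
    "\<And>x. x \<in> ball m r1 \<Longrightarrow> x \<in> M \<longleftrightarrow> F x = 0"
    "\<And>x y. x \<in> ball m r1 \<Longrightarrow> y \<in> ball m r1 \<Longrightarrow> \<bar>N m \<bullet> (x - y) - (F x - F y)\<bar> \<le> norm (x - y) / 2"
    by (rule interior_defining_function[OF ch N]) auto
  have contN: "continuous_on M N" using N by (simp add: gauss_map_def)
  then obtain r2 where r2: "r2 > 0" "\<And>x. x \<in> M \<Longrightarrow> dist x m < r2 \<Longrightarrow> dist (N x) (N m) < 1/4"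
    using mM unfolding continuous_on_iff by (metis zero_less_divide_1_iff zero_less_numeral)
  define r where "r = min r1 r2 / 2"
  have r: "r > 0" "2 * r \<le> r1" "2 * r \<le> r2" using r1 r2 by (auto simp: r_def)
  have sub: "ball m r \<subseteq> ball m r1" using r by auto
  have nm: "norm (N m) = 1" "N m \<bullet> N m = 1" using gauss_mapD[OF N mM] by auto
  show thesis
  proof
    show "r > 0" by fact
    show "ball m r \<inter> surface_boundary M = {}" using r1(2) sub by blast
    show "continuous_on (ball m r) F" using continuous_on_subset[OF r1(3) sub] .
    show "x \<in> M \<longleftrightarrow> F x = 0" if "x \<in> ball m r" for x using r1(4) sub that by blast
    have Fm: "F m = 0" using r1(4)[of m] r1(1) mM by simp
    show "F (m + t *\<^sub>R N m) > 0 \<and> F (m - t *\<^sub>R N m) < 0" if "0 < t" "t < r" for t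
      using sides_along_normal[OF r1(5) nm(1) Fm that(1)] that(2) r by auto
    fix x assume x: "x \<in> ball m r - M"
    define y where "y = closest_point M x"
    have y: "y \<in> M" "\<And>z. z \<in> M \<Longrightarrow> dist x y \<le> dist x z"
      using closest_point_in_set[OF closedM] closest_point_le[OF closedM] mM by (auto simp: y_def)
    have "dist x m < r" using x by (simp add: dist_commute)
    then have "dist y m < 2 * r"
      using y(2)[OF mM] dist_triangle[of y m x] by (simp add: dist_commute)
    then have yb: "y \<in> ball m r1" "dist y m < r2" using r by (auto simp: dist_commute)
    have yi: "y \<in> surface_interior M" using y yb r1(2) by (auto simp: surface_interior_def)
    obtain t where t: "x - y = t *\<^sub>R N y"
      by (rule nearest_point_along_normal[OF N yi H[OF yi] y(2)])
    have ny: "norm (N y) = 1" "N y \<bullet> N y = 1" using gauss_mapD[OF N y(1)] by auto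
    have "N y \<bullet> (x - y) = t" using t ny by simp
    then have side: "side M N x = (if t > 0 then 1 else -1)" by (simp add: side_def y_def)
    have "t \<noteq> 0" using t x y by auto
    have "norm (N y - N m) \<le> 1/4" using r2(2)[OF y(1) yb(2)] by (simp add: dist_norm)
    then have "N m \<bullet> N y \<ge> 3/4"
      using Cauchy_Schwarz_ineq2[of "N m" "N y - N m"] nm by (simp add: inner_diff_right)
    moreover have "F y = 0" using r1(4)[OF yb(1)] y by simp
    have xb: "x \<in> ball m r1" using x sub by blast
    have "\<bar>t * (N m \<bullet> N y) - F x\<bar> \<le> \<bar>t\<bar> / 2"
      using r1(5)[OF xb yb(1)] t ny \<open>F y = 0\<close> by simp
    ultimately show "side M N x = sgn (F x)"
    proof (cases "t > 0")
      case True
      then have "t * (N m \<bullet> N y) \<ge> t * (3/4)"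
        using \<open>N m \<bullet> N y \<ge> 3/4\<close> by (intro mult_left_mono) auto
      with True \<open>\<bar>t * (N m \<bullet> N y) - F x\<bar> \<le> \<bar>t\<bar> / 2\<close> have "F x > 0" by linarith
      then show ?thesis using side True by simp
    next
      case False
      then have "t < 0" using \<open>t \<noteq> 0\<close> by simp
      then have "t * (N m \<bullet> N y) \<le> t * (3/4)"
        using \<open>N m \<bullet> N y \<ge> 3/4\<close> by (intro mult_left_mono_neg) auto
      with \<open>t < 0\<close> \<open>\<bar>t * (N m \<bullet> N y) - F x\<bar> \<le> \<bar>t\<bar> / 2\<close> have "F x < 0" by linarith
      then show ?thesis using side \<open>t < 0\<close> by simp
    qed
  qed
qed

text \<open>A map to the punctured plane that crosses the positive real axis exactly at the interior of the
  surface, in the direction of the normal.  Its imaginary part is a distance function with the sign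
  of the side; away from the surface, where the sides have no meaning, the imaginary part vanishes
  and the real part is negative.\<close>

lemma crossing_map:
  assumes M: "compact M" "embedded_surface M" and N: "gauss_map M N"
    and bd: "closed (surface_boundary M)" "surface_boundary M \<noteq> {}" "surface_boundary M \<subseteq> M"
    and H: "\<And>p. p \<in> surface_interior M \<Longrightarrow> has_mean_curvature M N p (h p)"
  obtains f :: "real^3 \<Rightarrow> complex" where
    "continuous_on (- surface_boundary M) f"
    "\<And>x. x \<notin> surface_boundary M \<Longrightarrow> f x \<noteq> 0"
    "\<And>x. x \<notin> surface_boundary M \<Longrightarrow> Im (f x) = 0 \<and> Re (f x) > 0 \<longleftrightarrow> x \<in> M"
    "\<And>m. m \<in> surface_interior M \<Longrightarrow>
       \<exists>r>0. \<forall>x \<in> ball m r - M. side M N x * Im (f x) > 0"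
proof -
  define \<Gamma> where "\<Gamma> = surface_boundary M"
  have closedM: "closed M" and neM: "M \<noteq> {}" using M bd by (auto simp: compact_imp_closed)
  define good where "good m r F \<longleftrightarrow> r > 0 \<and> ball m r \<inter> \<Gamma> = {} \<and> continuous_on (ball m r) F \<and>
     (\<forall>x \<in> ball m r - M. F x \<noteq> 0 \<and> side M N x = sgn (F x))" for m r and F :: "real^3 \<Rightarrow> real"
  have ex: "\<exists>r F. good m r F" if m: "m \<in> surface_interior M" for m
  proof -
    obtain r F where "r > 0" "ball m r \<inter> surface_boundary M = {}" "continuous_on (ball m r) F"
      "\<And>x. x \<in> ball m r \<Longrightarrow> x \<in> M \<longleftrightarrow> F x = 0"
      "\<And>x. x \<in> ball m r - M \<Longrightarrow> side M N x = sgn (F x)"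
      by (rule side_local[OF M N bd(1) H m]) auto
    then have "good m r F" by (auto simp: good_def \<Gamma>_def)
    then show ?thesis by blast
  qed
  define U where "U = (\<Union>{ball m r | m r F. m \<in> surface_interior M \<and> good m r F})"
  have openU: "open U" by (auto simp: U_def)
  have U\<Gamma>: "U \<inter> \<Gamma> = {}" unfolding U_def good_def by blast
  have MU: "surface_interior M \<subseteq> U"
  proof
    fix m assume m: "m \<in> surface_interior M"
    then obtain r F where g: "good m r F" using ex by blast
    then have "m \<in> ball m r" by (simp add: good_def)
    with m g show "m \<in> U" unfolding U_def by blast
  qed
  have neU: "- U \<noteq> {}" using U\<Gamma> bd by (auto simp: \<Gamma>_def)
  have closedU: "closed (- U)" using openU by (rule closed_Compl)
  have dM: "infdist x M = 0 \<longleftrightarrow> x \<in> M" for x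
    using in_closed_iff_infdist_zero[OF closedM neM] by simp
  have dU: "infdist x (- U) = 0 \<longleftrightarrow> x \<notin> U" for x
    using in_closed_iff_infdist_zero[OF closedU neU] by simp
  \<comment> \<open>the distance from the surface, cut off so that it vanishes where the sides lose their meaning\<close>
  define \<beta> where "\<beta> x = min (infdist x M) (infdist x (- U))" for x
  define f where "f x = Complex (infdist x (- U) - infdist x M) (side M N x * \<beta> x)" for x
  have \<beta>0: "\<beta> x \<ge> 0" for x by (simp add: \<beta>_def infdist_nonneg)
  have cont\<beta>: "isCont \<beta> x" for x unfolding \<beta>_def by (intro continuous_intros)
  have MU': "x \<in> U" if "x \<in> M" "x \<notin> \<Gamma>" for x
    using MU that by (auto simp: surface_interior_def \<Gamma>_def)
  have \<beta>_iff: "\<beta> x = 0 \<longleftrightarrow> x \<in> M \<or> x \<notin> U" for x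
    using dM[of x] dU[of x] infdist_nonneg[of x M] infdist_nonneg[of x "- U"]
    by (auto simp: \<beta>_def min_def)
  have cont_side: "isCont (\<lambda>x. side M N x * \<beta> x) x" for x
  proof (cases "\<beta> x = 0")
    case True
    have "(\<beta> \<longlongrightarrow> 0) (at x)" using cont\<beta>[of x] True by (simp add: isCont_def)
    then have "((\<lambda>x. side M N x * \<beta> x) \<longlongrightarrow> 0) (at x)"
    proof (rule Lim_null_comparison[rotated])
      show "\<forall>\<^sub>F y in at x. norm (side M N y * \<beta> y) \<le> \<beta> y"
        using side_cases[of M N] \<beta>0 by (intro always_eventually allI) (smt (verit) mult_cancel_right1 mult_minus_left real_norm_def mult_1)
    qed
    then show ?thesis using True by (simp add: isCont_def)
  next
    case False
    then have x: "x \<notin> M" "x \<in> U" using \<beta>_iff by auto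
    then obtain m r F where mr: "x \<in> ball m r" "good m r F" by (auto simp: U_def)
    have F: "isCont F x" using mr by (auto simp: good_def continuous_on_eq_continuous_at)
    have Fx: "F x \<noteq> 0" using mr x by (auto simp: good_def)
    have c: "isCont (\<lambda>y. sgn (F y) * \<beta> y) x"
      by (intro continuous_intros F cont\<beta> Fx)
    have ev: "\<forall>\<^sub>F y in nhds x. side M N y * \<beta> y = sgn (F y) * \<beta> y"
    proof -
      have "open (ball m r - M)" "x \<in> ball m r - M" using closedM mr x by auto
      then have "\<forall>\<^sub>F y in nhds x. y \<in> ball m r - M" by (rule eventually_nhds_in_open)
      then show ?thesis by eventually_elim (use mr in \<open>auto simp: good_def\<close>)
    qed
    show ?thesis using c isCont_cong[OF ev] by blast
  qed
  show thesis
  proof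
    show "continuous_on (- surface_boundary M) f"
    proof -
      define g where "g x = side M N x * \<beta> x" for x
      have "continuous_on (- surface_boundary M) g"
        unfolding g_def using cont_side by (intro continuous_at_imp_continuous_on) blast
      moreover have "f = (\<lambda>x. of_real (infdist x (- U) - infdist x M) + \<i> * of_real (g x))"
        by (simp add: f_def g_def Complex_eq fun_eq_iff)
      ultimately show ?thesis by (auto intro!: continuous_intros)
    qed
    have sb: "side M N x \<noteq> 0" for x using side_cases[of M N x] by auto
    fix x assume x: "x \<notin> surface_boundary M"
    then have xM: "x \<in> U" if "x \<in> M" using MU' that by (auto simp: \<Gamma>_def)
    show "Im (f x) = 0 \<and> Re (f x) > 0 \<longleftrightarrow> x \<in> M"
      using dM[of x] dU[of x] xM infdist_nonneg[of x M] infdist_nonneg[of x "- U"]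
      by (auto simp: f_def sb \<beta>_iff less_le)
    show "f x \<noteq> 0"
      using dM[of x] dU[of x] xM
      by (auto simp: f_def sb \<beta>_iff complex_eq_iff)
  next
    fix m assume "m \<in> surface_interior M"
    then have "m \<in> U" using MU by blast
    then obtain r where r: "r > 0" "ball m r \<subseteq> U" using openU by (meson openE)
    have "side M N x * Im (f x) > 0" if "x \<in> ball m r - M" for x
    proof -
      have "\<beta> x \<noteq> 0" using that r \<beta>_iff by blast
      then have "\<beta> x > 0" using \<beta>0[of x] by simp
      then show ?thesis using side_cases[of M N x] by (auto simp: f_def)
    qed
    with r show "\<exists>r>0. \<forall>x \<in> ball m r - M. side M N x * Im (f x) > 0" by blast
  qed
qed

section \<open>Sheets of a logarithm\<close>

lemma integer_valued_continuous_constant: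
  fixes h :: "'a::topological_space \<Rightarrow> real"
  assumes "connected S" "continuous_on S h" "\<And>x. x \<in> S \<Longrightarrow> h x \<in> \<int>"
  shows "\<exists>k::int. \<forall>x\<in>S. h x = of_int k"
proof -
  have "h constant_on S"
  proof (rule continuous_discrete_range_constant[OF assms(1,2)])
    fix x assume x: "x \<in> S"
    have "1 \<le> norm (h y - h x)" if "y \<in> S" "h y \<noteq> h x" for y
    proof -
      have "h y - h x \<in> \<int>" using assms(3) x that by auto
      then show ?thesis using that Ints_nonzero_abs_ge1 by (metis eq_iff_diff_eq_0 real_norm_def)
    qed
    then show "\<exists>e>0. \<forall>y. y \<in> S \<and> h y \<noteq> h x \<longrightarrow> e \<le> norm (h y - h x)"
      by (intro exI[of _ 1]) auto
  qed
  then obtain c where c: "\<And>x. x \<in> S \<Longrightarrow> h x = c" by (auto simp: constant_on_def)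
  show ?thesis
  proof (cases "S = {}")
    case False
    then obtain x where "x \<in> S" by blast
    with c assms(3)[of x] show ?thesis by (auto elim!: Ints_cases)
  qed auto
qed

lemma logarithms_differ_by_period:
  assumes "connected S" "continuous_on S g1" "continuous_on S g2"
    and eq: "\<And>x. x \<in> S \<Longrightarrow> exp (g1 x) = exp (g2 x)"
  obtains k :: int where "\<And>x. x \<in> S \<Longrightarrow> g1 x = g2 x + of_int (2 * k) * of_real pi * \<i>"
proof -
  define h where "h x = (Im (g1 x) - Im (g2 x)) / (2 * pi)" for x
  have *: "\<exists>n::int. g1 x = g2 x + of_int (2 * n) * of_real pi * \<i>" if "x \<in> S" for x
    using eq[OF that] exp_eq[of "g1 x" "g2 x"] by auto
  have "h x \<in> \<int>" if "x \<in> S" for x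
    using *[OF that] by (auto simp: h_def)
  moreover have "continuous_on S h" unfolding h_def using assms by (intro continuous_intros) auto
  ultimately obtain k :: int where k: "\<And>x. x \<in> S \<Longrightarrow> h x = of_int k"
    using integer_valued_continuous_constant[OF assms(1)] by blast
  show thesis
  proof
    fix x assume x: "x \<in> S"
    from *[OF x] obtain n :: int where n: "g1 x = g2 x + of_int (2 * n) * of_real pi * \<i>" by blast
    then have "h x = of_int n" by (simp add: h_def)
    with k[OF x] n show "g1 x = g2 x + of_int (2 * k) * of_real pi * \<i>" by simp
  qed
qed

text \<open>Along a continuous logarithm of a map, the sheet is locally constant where the map avoids the positive
  real axis, and it increases by one when the map crosses that axis counterclockwise.\<close>

definition sheet :: "complex \<Rightarrow> int" where
  "sheet w = \<lfloor>Im w / (2 * pi)\<rfloor>"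

text \<open>The values of a logarithm at which the sheet changes are exactly those over the positive real axis.\<close>

lemma exp_positive_real_iff:
  "Im (exp w) = 0 \<and> Re (exp w) > 0 \<longleftrightarrow> Im w / (2 * pi) \<in> \<int>"
proof
  assume "Im (exp w) = 0 \<and> Re (exp w) > 0"
  then have s: "sin (Im w) = 0" "cos (Im w) > 0" by (auto simp: Im_exp Re_exp zero_less_mult_iff)
  then have "(cos (Im w))\<^sup>2 = 1" using sin_cos_squared_add[of "Im w"] by simp
  with s have "cos (Im w) = 1" by (auto simp: power2_eq_1_iff)
  then obtain k :: int where "Im w = of_int k * 2 * pi" by (auto simp: cos_one_2pi_int)
  then show "Im w / (2 * pi) \<in> \<int>" by simp
next
  assume "Im w / (2 * pi) \<in> \<int>"
  then obtain k :: int where "Im w / (2 * pi) = of_int k" by (auto elim: Ints_cases)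
  then have "Im w = 2 * pi * of_int k" by (simp add: field_simps)
  then have "sin (Im w) = 0" "cos (Im w) = 1" by (simp_all add: sin_int_2pin cos_int_2pin)
  then show "Im (exp w) = 0 \<and> Re (exp w) > 0" by (simp add: Im_exp Re_exp)
qed

lemma sheet_constant:
  assumes "connected S" "continuous_on S g"
    and off: "\<And>x. x \<in> S \<Longrightarrow> \<not> (Im (exp (g x)) = 0 \<and> Re (exp (g x)) > 0)"
    and xy: "x \<in> S" "y \<in> S"
  shows "sheet (g x) = sheet (g y)"
proof -
  define h where "h x = Im (g x) / (2 * pi)" for x
  have "continuous_on S h" unfolding h_def using assms(2) by (intro continuous_intros) auto
  then have "connected (h ` S)" using assms(1) by (rule connected_continuous_image)
  then have ivt: "z \<in> h ` S" if "h u \<le> z" "z \<le> h v" "u \<in> S" "v \<in> S" for u v z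
  proof -
    have "h u \<in> h ` S" "h v \<in> h ` S" using that by auto
    with \<open>connected (h ` S)\<close> that(1,2) show ?thesis unfolding connected_iff_interval by blast
  qed
  have noint: "of_int k \<notin> h ` S" for k :: int
  proof
    assume "of_int k \<in> h ` S"
    then obtain z where z: "z \<in> S" "h z = of_int k" by auto
    then have "h z \<in> \<int>" by simp
    then show False using off[OF z(1)] unfolding exp_positive_real_iff h_def by simp
  qed
  have "\<lfloor>h v\<rfloor> \<le> \<lfloor>h u\<rfloor>" if "u \<in> S" "v \<in> S" for u v
  proof (rule ccontr)
    assume "\<not> ?thesis"
    then have "h u \<le> of_int \<lfloor>h v\<rfloor>" by linarith
    then show False using ivt[of u "of_int \<lfloor>h v\<rfloor>" v] noint that by auto
  qed
  then show ?thesis using xy by (auto simp: sheet_def h_def intro: antisym)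
qed

text \<open>On the surface the imaginary part is a multiple \<open>2 \<pi> k\<close>, and nearby it differs from this by less
  than \<open>\<pi>\<close>, so the sign of the difference is the sign of its sine, that is, the side.\<close>

lemma sheet_near_surface:
  assumes cont: "continuous_on S g" and f: "\<And>x. x \<in> S \<Longrightarrow> f x = exp (g x)"
    and m: "m \<in> S" "Im (g m) / (2 * pi) = of_int k"
    and cross: "\<exists>r>0. \<forall>x \<in> ball m r - M. side M N x * Im (f x) > 0"
  obtains r where "r > 0"
    "\<And>x. x \<in> S \<inter> ball m r - M \<Longrightarrow> sheet (g x) = (if side M N x = 1 then k else k - 1)"
proof -
  obtain r1 where r1: "r1 > 0" "\<And>x. x \<in> ball m r1 - M \<Longrightarrow> side M N x * Im (f x) > 0"
    using cross by blast
  have "continuous_on S (\<lambda>x. Im (g x))" using cont by (intro continuous_intros) auto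
  then obtain r2 where r2: "r2 > 0" "\<And>x. x \<in> S \<Longrightarrow> dist x m < r2 \<Longrightarrow> \<bar>Im (g x) - Im (g m)\<bar> < pi"
    using m(1) pi_gt_zero unfolding continuous_on_iff dist_real_def by metis
  show thesis
  proof
    show "min r1 r2 > 0" using r1 r2 by simp
    fix x assume x: "x \<in> S \<inter> ball m (min r1 r2) - M"
    define \<theta> where "\<theta> = Im (g x) - Im (g m)"
    have \<theta>: "\<bar>\<theta>\<bar> < pi" using r2(2)[of x] x by (auto simp: \<theta>_def dist_commute)
    have gm: "Im (g m) = 2 * pi * of_int k" using m(2) by (simp add: field_simps)
    then have eq: "Im (g x) = \<theta> + 2 * pi * of_int k" by (simp add: \<theta>_def)
    then have "sin (Im (g x)) = sin \<theta>"
      by (simp add: sin_add sin_int_2pin cos_int_2pin)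
    moreover have "Im (f x) = exp (Re (g x)) * sin (Im (g x))" using f x by (simp add: Im_exp)
    moreover have "side M N x * Im (f x) > 0" using r1(2) x by auto
    ultimately have "exp (Re (g x)) * (side M N x * sin \<theta>) > 0" by (simp add: mult_ac)
    then have pos: "side M N x * sin \<theta> > 0" by (simp add: zero_less_mult_iff)
    have sheet: "sheet (g x) = \<lfloor>\<theta> / (2 * pi)\<rfloor> + k"
      unfolding sheet_def eq by (simp add: add_divide_distrib)
    show "sheet (g x) = (if side M N x = 1 then k else k - 1)"
    proof (cases "side M N x = 1")
      case True
      have "\<theta> > 0"
      proof (rule ccontr)
        assume "\<not> \<theta> > 0"
        then have "sin (- \<theta>) \<ge> 0" using \<theta> by (intro sin_ge_zero) auto
        then show False using pos True by simp
      qed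
      then have "\<lfloor>\<theta> / (2 * pi)\<rfloor> = 0" using \<theta> by (intro floor_unique) (auto simp: field_simps)
      then show ?thesis using sheet True by simp
    next
      case False
      then have s: "side M N x = -1" using side_cases by blast
      have "\<theta> < 0"
      proof (rule ccontr)
        assume "\<not> \<theta> < 0"
        then have "sin \<theta> \<ge> 0" using \<theta> by (intro sin_ge_zero) auto
        then show False using pos s by simp
      qed
      then have "\<lfloor>\<theta> / (2 * pi)\<rfloor> = -1" using \<theta> by (intro floor_unique) (auto simp: field_simps)
      then show ?thesis using sheet s by simp
    qed
  qed
qed

lemma sides_near_interior:
  assumes M: "compact M" "embedded_surface M" and N: "gauss_map M N"
    and bd: "closed (surface_boundary M)"
    and H: "\<And>p. p \<in> surface_interior M \<Longrightarrow> has_mean_curvature M N p (h p)"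
    and m: "m \<in> surface_interior M"
  obtains r where "r > 0"
    "\<And>t. 0 < t \<Longrightarrow> t < r \<Longrightarrow> m + t *\<^sub>R N m \<notin> M \<and> side M N (m + t *\<^sub>R N m) = 1"
    "\<And>t. 0 < t \<Longrightarrow> t < r \<Longrightarrow> m - t *\<^sub>R N m \<notin> M \<and> side M N (m - t *\<^sub>R N m) = -1"
proof -
  have n1: "norm (N m) = 1" using gauss_mapD(1)[OF N] m by (auto simp: surface_interior_def)
  obtain r F where r: "r > 0" "\<And>x. x \<in> ball m r \<Longrightarrow> x \<in> M \<longleftrightarrow> F x = 0"
      "\<And>x. x \<in> ball m r - M \<Longrightarrow> side M N x = sgn (F x)"
      "\<And>t. 0 < t \<Longrightarrow> t < r \<Longrightarrow> F (m + t *\<^sub>R N m) > 0 \<and> F (m - t *\<^sub>R N m) < 0"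
    by (rule side_local[OF M N bd H m]) auto
  show thesis
  proof
    show "r > 0" by fact
    fix t assume t: "0 < t" "t < r"
    have b: "m + t *\<^sub>R N m \<in> ball m r" "m - t *\<^sub>R N m \<in> ball m r" using t n1 by (auto simp: dist_norm)
    show "m + t *\<^sub>R N m \<notin> M \<and> side M N (m + t *\<^sub>R N m) = 1"
      using r(2)[OF b(1)] r(3)[of "m + t *\<^sub>R N m"] r(4)[OF t] b by auto
    show "m - t *\<^sub>R N m \<notin> M \<and> side M N (m - t *\<^sub>R N m) = -1"
      using r(2)[OF b(2)] r(3)[of "m - t *\<^sub>R N m"] r(4)[OF t] b by auto
  qed
qed

section \<open>Normals at a highest and a lowest point\<close>

text \<open>The open half-space beyond the extremal point \<open>p\<close>, together with a ray that leaves the plane at \<open>x0\<close>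
  and misses the surface, is a connected set off the surface.  The sheet is constant on it and is
  known next to \<open>p\<close>.  With \<open>- e\<close> for \<open>e\<close> this covers the lowest point.\<close>

lemma sheet_beyond_extremal_point:
  assumes M: "compact M" "embedded_surface M" and N: "gauss_map M N"
    and bd: "closed (surface_boundary M)"
    and H: "\<And>p. p \<in> surface_interior M \<Longrightarrow> has_mean_curvature M N p (h p)"
    and cross: "\<And>x. x \<notin> surface_boundary M \<Longrightarrow> Im (f x) = 0 \<and> Re (f x) > 0 \<longleftrightarrow> x \<in> M"
      "\<And>m. m \<in> surface_interior M \<Longrightarrow> \<exists>r>0. \<forall>x \<in> ball m r - M. side M N x * Im (f x) > 0"
    and plane: "surface_boundary M \<subseteq> M" "surface_boundary M \<subseteq> {x. e \<bullet> x = b}" and e: "norm e = 1"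
    and g: "continuous_on ({x. e \<bullet> x \<ge> b} - surface_boundary M) g"
      "\<And>x. x \<in> {x. e \<bullet> x \<ge> b} - surface_boundary M \<Longrightarrow> f x = exp (g x)"
    and p: "p \<in> M" "e \<bullet> p > b" "\<And>x. x \<in> M \<Longrightarrow> e \<bullet> x \<le> e \<bullet> p" "Im (g p) / (2 * pi) = of_int k"
      "N p = \<tau> *\<^sub>R e" "\<tau> = 1 \<or> \<tau> = -1"
    and x0: "e \<bullet> x0 = b" "\<And>t. t \<ge> 0 \<Longrightarrow> x0 + t *\<^sub>R e \<notin> M"
  shows "sheet (g x0) = (if \<tau> = 1 then k else k - 1)"
proof -
  define D where "D = {x. e \<bullet> x \<ge> b} - surface_boundary M"
  have ee: "e \<bullet> e = 1" using e by (simp add: dot_square_norm)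
  have pi: "p \<in> surface_interior M" using p(1,2) plane by (auto simp: surface_interior_def)
  define A where "A = {y. e \<bullet> y > e \<bullet> p}"
  define B where "B = (\<lambda>t. x0 + t *\<^sub>R e) ` {0::real..}"
  define T where "T = A \<union> B"
  have "connected A" unfolding A_def by (intro convex_connected convex_halfspace_gt)
  moreover have "connected B" unfolding B_def
    by (intro connected_continuous_image continuous_intros convex_connected) auto
  moreover have "A \<inter> B \<noteq> {}"
  proof -
    define t where "t = e \<bullet> p - b + 1"
    have "x0 + t *\<^sub>R e \<in> A" using x0 ee by (simp add: A_def t_def inner_add_right)
    moreover have "x0 + t *\<^sub>R e \<in> B" using p by (auto simp: B_def t_def)
    ultimately show ?thesis by blast
  qed
  ultimately have "connected T" unfolding T_def by (rule connected_Un)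
  have TM: "x \<notin> M" if "x \<in> T" for x
    using that p(3)[of x] x0(2) by (auto simp: T_def A_def B_def)
  have TD: "T \<subseteq> D"
  proof
    fix x assume x: "x \<in> T"
    have "e \<bullet> x \<ge> b" using x p(2) x0 ee by (auto simp: T_def A_def B_def inner_add_right)
    then show "x \<in> D" using TM[OF x] plane by (auto simp: D_def)
  qed
  have pD: "p \<in> D" using p pi by (auto simp: D_def surface_interior_def)
  obtain r1 where r1: "r1 > 0"
    "\<And>x. x \<in> D \<inter> ball p r1 - M \<Longrightarrow> sheet (g x) = (if side M N x = 1 then k else k - 1)"
    by (rule sheet_near_surface[OF g[folded D_def] pD p(4) cross(2)[OF pi]]) auto
  obtain r2 where r2: "r2 > 0"
    "\<And>t. 0 < t \<Longrightarrow> t < r2 \<Longrightarrow> p + t *\<^sub>R N p \<notin> M \<and> side M N (p + t *\<^sub>R N p) = 1"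
    "\<And>t. 0 < t \<Longrightarrow> t < r2 \<Longrightarrow> p - t *\<^sub>R N p \<notin> M \<and> side M N (p - t *\<^sub>R N p) = -1"
    by (rule sides_near_interior[OF M N bd H pi]) auto
  define t where "t = min r1 r2 / 2"
  have t: "0 < t" "t < r1" "t < r2" using r1 r2 by (auto simp: t_def)
  define x where "x = p + t *\<^sub>R e"
  have "x \<in> A" using t ee by (simp add: x_def A_def inner_add_right)
  then have xT: "x \<in> T" by (simp add: T_def)
  have "side M N x = \<tau>"
    using p(5,6) r2(2,3)[of t] t by (auto simp: x_def)
  moreover have "x \<in> D \<inter> ball p r1 - M"
    using xT TD TM t e by (auto simp: x_def dist_norm)
  ultimately have "sheet (g x) = (if \<tau> = 1 then k else k - 1)" using r1(2) by simp
  moreover have "sheet (g x) = sheet (g x0)"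
  proof (rule sheet_constant[OF \<open>connected T\<close> continuous_on_subset[OF g(1)[folded D_def] TD]])
    fix z assume z: "z \<in> T"
    then have "z \<in> D" "z \<notin> M" using TD TM by auto
    then show "\<not> (Im (exp (g z)) = 0 \<and> Re (exp (g z)) > 0)"
      using g(2)[of z] cross(1)[of z] by (auto simp: D_def)
  next
    show "x \<in> T" by fact
    show "x0 \<in> T" by (auto simp: T_def B_def intro!: image_eqI[of _ _ 0])
  qed
  ultimately show ?thesis by simp
qed

text \<open>Segments from a point of the open half-space reach the bounding plane only at their ends, so
  removing any part of that plane leaves a starlike set.\<close>

lemma closed_half_space_minus_contractible:
  fixes e :: "'a::real_inner"
  assumes "S \<subseteq> {x. e \<bullet> x = b}" "e \<bullet> p > b"
  shows "contractible ({x. e \<bullet> x \<ge> b} - S)"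
proof (rule starlike_imp_contractible)
  show "starlike ({x. e \<bullet> x \<ge> b} - S)"
    unfolding starlike_def
  proof (intro bexI ballI subsetI)
    show "p \<in> {x. e \<bullet> x \<ge> b} - S" using assms by auto
    fix x z assume x: "x \<in> {x. e \<bullet> x \<ge> b} - S" and "z \<in> closed_segment p x"
    then obtain u where u: "0 \<le> u" "u \<le> 1" "z = (1 - u) *\<^sub>R p + u *\<^sub>R x"
      by (auto simp: closed_segment_def)
    show "z \<in> {x. e \<bullet> x \<ge> b} - S"
    proof (cases "u = 1")
      case True
      then show ?thesis using u x by simp
    next
      case False
      then have "(1 - u) * (e \<bullet> p) > (1 - u) * b" "u * (e \<bullet> x) \<ge> u * b"
        using u x assms by (auto intro: mult_left_mono)
      moreover have "e \<bullet> z = (1 - u) * (e \<bullet> p) + u * (e \<bullet> x)"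
        by (simp add: u(3) inner_add_right)
      moreover have "(1 - u) * b + u * b = b" by (simp add: algebra_simps)
      ultimately have "e \<bullet> z > b" by linarith
      then show ?thesis using assms by auto
    qed
  qed
qed

text \<open>A logarithm of the crossing map cannot exist near a boundary point: the complement of the
  surface is locally connected there, but the sheet jumps across the surface.\<close>

lemma no_logarithm_around_boundary:
  assumes M: "compact M" "embedded_surface M" and N: "gauss_map M N"
    and bd: "closed (surface_boundary M)" "surface_boundary M \<noteq> {}" "surface_boundary M \<subseteq> M"
    and H: "\<And>p. p \<in> surface_interior M \<Longrightarrow> has_mean_curvature M N p (h p)"
    and cross: "\<And>x. x \<notin> surface_boundary M \<Longrightarrow> Im (f x) = 0 \<and> Re (f x) > 0 \<longleftrightarrow> x \<in> M"
      "\<And>m. m \<in> surface_interior M \<Longrightarrow> \<exists>r>0. \<forall>x \<in> ball m r - M. side M N x * Im (f x) > 0"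
    and g: "continuous_on (- surface_boundary M) g"
      "\<And>x. x \<in> - surface_boundary M \<Longrightarrow> f x = exp (g x)"
  shows False
proof -
  obtain m where m: "m \<in> surface_boundary M" using bd by blast
  obtain \<phi> V x where c: "local_param M \<phi> V" "x \<in> V" "x $ 2 = 0" "\<phi> x = m"
    using m by (auto simp: surface_boundary_def)
  obtain O' where O': "open O'" "m \<in> O'" "connected (O' - M)"
    by (rule boundary_complement_connected[OF c N open_UNIV]) auto
  obtain W where W: "open W" "m \<in> W" "W \<subseteq> O'" "surface_interior M \<inter> W \<noteq> {}"
    by (rule surface_interior_locally_connected_at[OF M(2) N _ O'(1,2)]) (use m bd in auto)
  then obtain y where y: "y \<in> surface_interior M" "y \<in> O'" by blast
  have n1: "norm (N y) = 1" using gauss_mapD(1)[OF N] y by (auto simp: surface_interior_def)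
  have yD: "y \<in> - surface_boundary M" and yM: "y \<in> M" using y by (auto simp: surface_interior_def)
  have "Im (g y) / (2 * pi) \<in> \<int>"
    using cross(1)[of y] g(2)[OF yD] yD yM unfolding exp_positive_real_iff[symmetric] by auto
  then obtain k where k: "Im (g y) / (2 * pi) = of_int k" by (auto elim: Ints_cases)
  obtain r1 where r1: "r1 > 0" "\<And>x. x \<in> - surface_boundary M \<inter> ball y r1 - M \<Longrightarrow>
      sheet (g x) = (if side M N x = 1 then k else k - 1)"
    by (rule sheet_near_surface[OF g yD k cross(2)[OF y(1)]]) auto
  obtain r2 where r2: "r2 > 0"
    "\<And>t. 0 < t \<Longrightarrow> t < r2 \<Longrightarrow> y + t *\<^sub>R N y \<notin> M \<and> side M N (y + t *\<^sub>R N y) = 1"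
    "\<And>t. 0 < t \<Longrightarrow> t < r2 \<Longrightarrow> y - t *\<^sub>R N y \<notin> M \<and> side M N (y - t *\<^sub>R N y) = -1"
    by (rule sides_near_interior[OF M N bd(1) H y(1)]) auto
  obtain r3 where r3: "r3 > 0" "ball y r3 \<subseteq> O'" using O' y by (meson openE)
  define t where "t = min r1 (min r2 r3) / 2"
  have t: "0 < t" "t < r1" "t < r2" "t < r3" using r1 r2 r3 by (auto simp: t_def)
  define u v where "u = y + t *\<^sub>R N y" and "v = y - t *\<^sub>R N y"
  have dist: "dist y u = t" "dist y v = t" using t n1 by (auto simp: u_def v_def dist_norm)
  have nM: "u \<notin> M" "v \<notin> M" "side M N u = 1" "side M N v = -1"
    using r2(2,3)[OF t(1,3)] by (auto simp: u_def v_def)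
  have "u \<in> O' - M" "v \<in> O' - M" using nM dist t r3(2) by auto
  moreover have "O' - M \<subseteq> - surface_boundary M" using bd by auto
  moreover have "\<not> (Im (exp (g z)) = 0 \<and> Re (exp (g z)) > 0)" if "z \<in> O' - M" for z
    using cross(1)[of z] g(2)[of z] that bd by auto
  ultimately have "sheet (g u) = sheet (g v)"
    using sheet_constant[OF O'(3) continuous_on_subset[OF g(1)]] by blast
  moreover have "sheet (g u) = k" "sheet (g v) = k - 1"
    using r1(2)[of u] r1(2)[of v] nM dist t bd by auto
  ultimately show False by simp
qed

lemma exists_point_far_along_normal:
  fixes e :: "real^3"
  assumes e: "norm e = 1" and K: "bounded K"
  obtains x0 where "e \<bullet> x0 = b" "\<And>t. x0 + t *\<^sub>R e \<notin> K"
proof -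
  obtain R where R: "\<And>x. x \<in> K \<Longrightarrow> norm x \<le> R" using K by (auto simp: bounded_iff)
  obtain w' :: "real^3" where w': "w' \<noteq> 0" "orthogonal e w'"
    by (rule orthogonal_to_vector_exists[of e]) auto
  define w where "w = w' /\<^sub>R norm w'"
  have w: "norm w = 1" "w \<bullet> e = 0" using w' by (simp_all add: w_def orthogonal_def inner_commute)
  have sq: "e \<bullet> e = 1" "w \<bullet> w = 1" using e w by (simp_all add: dot_square_norm)
  define s where "s = \<bar>R\<bar> + 1"
  define x0 where "x0 = b *\<^sub>R e + s *\<^sub>R w"
  show thesis
  proof
    show "e \<bullet> x0 = b" using sq w by (simp add: x0_def inner_add_right inner_commute)
    fix t
    have "w \<bullet> (x0 + t *\<^sub>R e) = s" using sq w by (simp add: x0_def inner_add_right)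
    moreover have "\<bar>w \<bullet> (x0 + t *\<^sub>R e)\<bar> \<le> norm (x0 + t *\<^sub>R e)"
      using Cauchy_Schwarz_ineq2[of w "x0 + t *\<^sub>R e"] w by simp
    ultimately have "norm (x0 + t *\<^sub>R e) > R" by (simp add: s_def)
    then show "x0 + t *\<^sub>R e \<notin> K" using R[of "x0 + t *\<^sub>R e"] by auto
  qed
qed

text \<open>The logarithms \<open>g1\<close> and \<open>g3\<close> on the two half-spaces agree on \<open>\<Omega>\<close>.  The interior of \<open>M\<close> meets the
  plane only in \<open>\<Omega>\<close>, so together they give a continuous function on it, whose imaginary part is a
  constant multiple \<open>2 \<pi> k\<close>.  If the normals at \<open>p\<close> and \<open>q\<close> are opposite, the regions above \<open>p\<close> and below
  \<open>q\<close> are on the same side, so both logarithms have the same sheet at a point \<open>x0\<close> far away in the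
  plane.  On the exterior of \<open>\<Omega>\<close> they differ by a multiple of the period, which must then be zero.\<close>

lemma normals_at_extremal_points_agree:
  assumes M: "compact M" "embedded_surface M" "connected M" and N: "gauss_map M N"
    and bd: "closed (surface_boundary M)" "surface_boundary M \<noteq> {}" "surface_boundary M \<subseteq> M"
    and H: "\<And>p. p \<in> surface_interior M \<Longrightarrow> has_mean_curvature M N p (h p)"
    and e: "norm e = 1" and P: "P = {x. e \<bullet> x = b}"
    and \<Omega>: "connected \<Omega>" "connected (P - closure \<Omega>)" "bounded \<Omega>" "\<Omega> \<subseteq> P"
      "closure \<Omega> = \<Omega> \<union> surface_boundary M" "\<Omega> \<inter> surface_boundary M = {}"
      "surface_boundary M \<subseteq> P"
    and disj: "M \<inter> (P - closure \<Omega>) = {}"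
    and p: "p \<in> M" "e \<bullet> p > b" "\<And>x. x \<in> M \<Longrightarrow> e \<bullet> x \<le> e \<bullet> p"
    and q: "q \<in> M" "e \<bullet> q < b" "\<And>x. x \<in> M \<Longrightarrow> e \<bullet> x \<ge> e \<bullet> q"
  shows "N p = N q"
proof (rule ccontr)
  assume neq: "N p \<noteq> N q"
  define \<Gamma> where "\<Gamma> = surface_boundary M"
  have \<Gamma>P: "\<Gamma> \<subseteq> {x. e \<bullet> x = b}" using \<Omega>(7) P by (simp add: \<Gamma>_def)
  have pi: "p \<in> surface_interior M" and qi: "q \<in> surface_interior M"
    using p q \<Gamma>P by (auto simp: surface_interior_def \<Gamma>_def)
  have Np: "N p = e \<or> N p = - e"
    by (rule normal_at_touching_point[OF N pi H[OF pi] e]) (use p in auto)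
  have Nq: "N q = - e \<or> N q = - (- e)"
    by (rule normal_at_touching_point[OF N qi H[OF qi]]) (use q e in auto)
  obtain \<tau> :: real where \<tau>: "N p = \<tau> *\<^sub>R e" "\<tau> = 1 \<or> \<tau> = -1"
    using Np that[of 1] that[of "-1"] by auto
  have \<tau>q: "N q = \<tau> *\<^sub>R (- e)" using \<tau> Np Nq neq by auto
  obtain f where f: "continuous_on (- surface_boundary M) f"
    "\<And>x. x \<notin> surface_boundary M \<Longrightarrow> f x \<noteq> 0"
    and cross: "\<And>x. x \<notin> surface_boundary M \<Longrightarrow> Im (f x) = 0 \<and> Re (f x) > 0 \<longleftrightarrow> x \<in> M"
    "\<And>m. m \<in> surface_interior M \<Longrightarrow> \<exists>r>0. \<forall>x \<in> ball m r - M. side M N x * Im (f x) > 0"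
    by (rule crossing_map[OF M(1,2) N bd H]) auto
  define D1 where "D1 = {x. e \<bullet> x \<ge> b} - \<Gamma>"
  define D2 where "D2 = {x. (- e) \<bullet> x \<ge> - b} - \<Gamma>"
  have D12: "D1 \<union> D2 = - \<Gamma>" "D1 \<inter> D2 = P - \<Gamma>" by (auto simp: D1_def D2_def P)
  have fD: "continuous_on D f" "\<And>x. x \<in> D \<Longrightarrow> f x \<noteq> 0" if "D \<subseteq> - \<Gamma>" for D
    using f that continuous_on_subset by (auto simp: \<Gamma>_def)
  have "contractible D1" unfolding D1_def
    by (rule closed_half_space_minus_contractible[OF \<Gamma>P p(2)])
  then obtain g1 where g1: "continuous_on D1 g1" "\<And>x. x \<in> D1 \<Longrightarrow> f x = exp (g1 x)"
    using continuous_logarithm_on_contractible[OF fD(1)] fD(2) D12 by (metis Un_upper1)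
  have "contractible D2" unfolding D2_def
    by (rule closed_half_space_minus_contractible[where p = q]) (use \<Gamma>P q in auto)
  then obtain g2 where g2: "continuous_on D2 g2" "\<And>x. x \<in> D2 \<Longrightarrow> f x = exp (g2 x)"
    using continuous_logarithm_on_contractible[OF fD(1)] fD(2) D12 by (metis Un_upper2)
  have \<Omega>D: "\<Omega> \<subseteq> D1 \<inter> D2" using \<Omega>(4,6) D12 by (auto simp: \<Gamma>_def)
  obtain n :: int where n: "\<And>x. x \<in> \<Omega> \<Longrightarrow> g1 x = g2 x + of_int (2 * n) * of_real pi * \<i>"
  proof (rule logarithms_differ_by_period[OF \<Omega>(1)])
    show "continuous_on \<Omega> g1" "continuous_on \<Omega> g2" using g1 g2 \<Omega>D continuous_on_subset by blast+
    show "exp (g1 x) = exp (g2 x)" if "x \<in> \<Omega>" for x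
    proof -
      have "x \<in> D1" "x \<in> D2" using \<Omega>D that by auto
      from g1(2)[OF this(1)] g2(2)[OF this(2)] show ?thesis by simp
    qed
  qed blast
  define g3 where "g3 x = g2 x + of_int (2 * n) * of_real pi * \<i>" for x
  have exp_period: "exp (of_int (2 * n) * of_real pi * \<i>) = 1"
    using exp_eq_1[of "of_int (2 * n) * of_real pi * \<i>"] by auto
  have g3: "continuous_on D2 g3" "\<And>x. x \<in> D2 \<Longrightarrow> f x = exp (g3 x)"
    unfolding g3_def using g2 exp_period by (auto intro!: continuous_intros simp: exp_add)
  have g13: "g1 x = g3 x" if "x \<in> \<Omega>" for x using n[OF that] by (simp add: g3_def)
  define g where "g x = (if e \<bullet> x \<ge> b then g1 x else g3 x)" for x
  have g_eq1: "g x = g1 x" if "x \<in> D1" for x using that by (auto simp: g_def D1_def)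
  define I where "I = surface_interior M"
  have I: "I = M - \<Gamma>" by (simp add: I_def \<Gamma>_def surface_interior_def)
  have IP: "x \<in> \<Omega>" if "x \<in> I" "e \<bullet> x = b" for x
    using that disj \<Omega>(5) by (auto simp: I P \<Gamma>_def)
  have g_eq3: "g x = g3 x" if "x \<in> I \<inter> D2" for x
    using that IP[of x] g13 by (force simp: g_def D2_def)
  have ID: "I = (I \<inter> D1) \<union> (I \<inter> D2)" using D12(1) by (auto simp: I)
  have clI: "closedin (top_of_set I) (I \<inter> D1)" "closedin (top_of_set I) (I \<inter> D2)"
  proof -
    have "I \<inter> D1 = I \<inter> {x. e \<bullet> x \<ge> b}" "I \<inter> D2 = I \<inter> {x. e \<bullet> x \<le> b}"
      by (auto simp: I D1_def D2_def)
    then show "closedin (top_of_set I) (I \<inter> D1)" "closedin (top_of_set I) (I \<inter> D2)"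
      using closed_halfspace_ge[of b e] closed_halfspace_le[of e b] by (auto intro: closedin_closed_Int)
  qed
  have contI: "continuous_on I g"
  proof (subst ID, rule continuous_on_Un_local)
    show "continuous_on (I \<inter> D1) g"
      by (rule continuous_on_eq[OF continuous_on_subset[OF g1(1)]]) (use g_eq1 in auto)
    show "continuous_on (I \<inter> D2) g"
      by (rule continuous_on_eq[OF continuous_on_subset[OF g3(1)]]) (use g_eq3 in auto)
  qed (use clI ID in simp_all)
  have "connected I" unfolding I_def by (rule surface_interior_connected[OF M(2) N M(3)])
  have gf: "f x = exp (g x)" if "x \<in> I" for x
  proof (cases "x \<in> D1")
    case True then show ?thesis using g1(2) g_eq1 by simp
  next
    case False
    then have "x \<in> I \<inter> D2" using ID that by blast
    then show ?thesis using g3(2) g_eq3 by auto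
  qed
  obtain k :: int where k: "\<And>x. x \<in> I \<Longrightarrow> Im (g x) / (2 * pi) = of_int k"
  proof -
    have "continuous_on I (\<lambda>x. Im (g x) / (2 * pi))" using contI by (intro continuous_intros) auto
    moreover have "Im (g x) / (2 * pi) \<in> \<int>" if "x \<in> I" for x
      using cross(1)[of x] gf[OF that] that unfolding exp_positive_real_iff[symmetric]
      by (auto simp: I \<Gamma>_def)
    ultimately show thesis
      using integer_valued_continuous_constant[OF \<open>connected I\<close>] that by blast
  qed
  have "bounded (M \<union> closure \<Omega>)" using M(1) \<Omega>(3) by (simp add: compact_imp_bounded)
  then obtain x0 where x0: "e \<bullet> x0 = b" "\<And>t. x0 + t *\<^sub>R e \<notin> M \<union> closure \<Omega>"
    by (rule exists_point_far_along_normal[OF e, where b = b]) blast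
  have x0': "x0 \<in> P - closure \<Omega>" using x0(1) x0(2)[of 0] by (simp add: P)
  have p_k: "Im (g1 p) / (2 * pi) = of_int k"
    using k[of p] pi p(2) by (simp add: I_def g_def)
  have s1: "sheet (g1 x0) = (if \<tau> = 1 then k else k - 1)"
    by (rule sheet_beyond_extremal_point[OF M(1,2) N bd(1) H cross bd(3) \<Gamma>P[unfolded \<Gamma>_def] e
        g1[unfolded D1_def \<Gamma>_def] p p_k \<tau>]) (use x0 in auto)
  have q_k: "Im (g3 q) / (2 * pi) = of_int k"
    using k[of q] qi q(2) by (simp add: I_def g_def)
  have s3: "sheet (g3 x0) = (if \<tau> = 1 then k else k - 1)"
  proof (rule sheet_beyond_extremal_point[where e = "- e" and b = "- b" and p = q and f = f and g = g3,
        OF M(1,2) N bd(1) H cross bd(3)])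
    show "surface_boundary M \<subseteq> {x. (- e) \<bullet> x = - b}" using \<Gamma>P by (auto simp: \<Gamma>_def)
    show "continuous_on ({x. - b \<le> (- e) \<bullet> x} - surface_boundary M) g3"
      using g3(1) unfolding D2_def \<Gamma>_def .
    show "f x = exp (g3 x)" if "x \<in> {x. - b \<le> (- e) \<bullet> x} - surface_boundary M" for x
      using g3(2) that unfolding D2_def \<Gamma>_def .
    show "x0 + t *\<^sub>R (- e) \<notin> M" for t using x0(2)[of "- t"] by simp
  qed (use x0(1) q e q_k \<tau>q \<tau>(2) in simp_all)
  define E where "E = P - closure \<Omega>"
  have ED: "E \<subseteq> D1 \<inter> D2" using D12 \<Omega>(5) by (auto simp: E_def \<Gamma>_def)
  obtain j :: int where j: "\<And>x. x \<in> E \<Longrightarrow> g1 x = g3 x + of_int (2 * j) * of_real pi * \<i>"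
  proof (rule logarithms_differ_by_period[OF \<Omega>(2)[folded E_def]])
    show "continuous_on E g1" "continuous_on E g3" using g1 g3 ED continuous_on_subset by blast+
    show "exp (g1 x) = exp (g3 x)" if "x \<in> E" for x
    proof -
      have "x \<in> D1" "x \<in> D2" using ED that by auto
      from g1(2)[OF this(1)] g3(2)[OF this(2)] show ?thesis by simp
    qed
  qed blast
  have "Im (g1 x0) / (2 * pi) = Im (g3 x0) / (2 * pi) + of_int j"
    using j[of x0] x0' by (simp add: E_def add_divide_distrib)
  then have "sheet (g1 x0) = sheet (g3 x0) + j" by (simp add: sheet_def)
  then have "j = 0" using s1 s3 by simp
  then have g13': "g1 x = g3 x" if "x \<in> D1 \<inter> D2" for x
    using that j[of x] g13[of x] D12(2) \<Omega>(5) by (auto simp: E_def \<Gamma>_def)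
  define G where "G x = (if e \<bullet> x \<ge> b then g1 x else g3 x)" for x
  have G1: "G x = g1 x" if "x \<in> D1" for x using that by (auto simp: G_def D1_def)
  have G3: "G x = g3 x" if "x \<in> D2" for x
    using that g13'[of x] by (auto simp: G_def D1_def D2_def)
  have "continuous_on (D1 \<union> D2) G"
  proof (rule continuous_on_Un_local)
    have "D1 = (D1 \<union> D2) \<inter> {x. e \<bullet> x \<ge> b}" "D2 = (D1 \<union> D2) \<inter> {x. e \<bullet> x \<le> b}"
      by (auto simp: D1_def D2_def)
    then show "closedin (top_of_set (D1 \<union> D2)) D1" "closedin (top_of_set (D1 \<union> D2)) D2"
      using closed_halfspace_ge[of b e] closed_halfspace_le[of e b] by (metis closedin_closed_Int)+
    show "continuous_on D1 G" "continuous_on D2 G"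
      using continuous_on_eq[OF g1(1)] continuous_on_eq[OF g3(1)] G1 G3 by simp_all
  qed
  then have "continuous_on (- \<Gamma>) G" by (simp add: D12)
  moreover have "f x = exp (G x)" if "x \<in> - \<Gamma>" for x
    using that D12(1) G1 G3 g1(2) g3(2) by (metis UnE)
  ultimately show False
    using no_logarithm_around_boundary[OF M(1,2) N bd H cross] unfolding \<Gamma>_def by blast
qed

section \<open>Surfaces spanning a planar curve\<close>

lemma Ck_on_submanifold_1_imp_lipschitz_at:
  fixes f :: "'a::euclidean_space \<Rightarrow> 'b::euclidean_space"
  assumes "Ck_on_submanifold 1 f S" "p \<in> S"
  obtains K \<rho> where "K \<ge> 0" "\<rho> > 0"
    "\<And>x. x \<in> S \<Longrightarrow> norm (x - p) < \<rho> \<Longrightarrow> norm (f x - f p) \<le> K * norm (x - p)"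
proof -
  obtain U g where U: "open U" "p \<in> U" "Ck_on 1 g U" "\<And>x. x \<in> S \<inter> U \<Longrightarrow> g x = f x"
  proof -
    have "\<exists>U g. open U \<and> p \<in> U \<and> Ck_on 1 g U \<and> (\<forall>x\<in>S \<inter> U. g x = f x)"
      using assms unfolding Ck_on_submanifold_def by (rule bspec)
    then show thesis using that by (elim exE conjE) simp
  qed
  define D where "D = frechet_derivative g (at p)"
  have lin: "bounded_linear D"
    unfolding D_def by (rule has_derivative_bounded_linear[OF Ck_on_1_imp_has_derivative[OF U(3,2)]])
  obtain r where r: "r > 0" "ball p r \<subseteq> U"
    "\<And>x y. x \<in> ball p r \<Longrightarrow> y \<in> ball p r \<Longrightarrow> norm (g x - g y - D (x - y)) \<le> 1 * norm (x - y)"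
    unfolding D_def by (rule Ck_on_1_strict_derivative[OF U(1,3,2) zero_less_one]) auto
  show thesis
  proof
    show "onorm D + 1 \<ge> 0" using onorm_pos_le[OF lin] by simp
    show "r > 0" by fact
    fix x assume x: "x \<in> S" "norm (x - p) < r"
    then have b: "x \<in> ball p r" "p \<in> ball p r" using r(1) by (auto simp: dist_norm norm_minus_commute)
    then have "g x = f x" "g p = f p" using U(2,4) x assms(2) r(2) by auto
    moreover have "norm (g x - g p) \<le> norm (g x - g p - D (x - p)) + norm (D (x - p))"
      using norm_triangle_ineq[of "g x - g p - D (x - p)" "D (x - p)"] by simp
    moreover have "norm (D (x - p)) \<le> onorm D * norm (x - p)" by (rule onorm[OF lin])
    ultimately show "norm (f x - f p) \<le> (onorm D + 1) * norm (x - p)"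
      using r(3)[OF b] by (simp add: algebra_simps)
  qed
qed

text \<open>The Hessian of a linear function vanishes.\<close>

lemma mean_curvature_sign_at_extremal_point:
  assumes N: "gauss_map M N" and p: "p \<in> surface_interior M"
    and H: "has_mean_curvature M N p h"
    and max: "\<And>x. x \<in> M \<Longrightarrow> e \<bullet> x \<le> e \<bullet> p"
  obtains \<mu> where "e = \<mu> *\<^sub>R N p" "\<mu> * h \<le> 0"
proof -
  obtain \<mu> e1 e2 where "e = \<mu> *\<^sub>R N p"
    "(\<lambda>v::real^3. 0::real^3) e1 \<bullet> e1 + (\<lambda>v::real^3. 0::real^3) e2 \<bullet> e2 + 2 * \<mu> * h \<le> 0"
  proof (rule mean_curvature_inequality_at_max[OF N p H, where \<psi> = "\<lambda>x. e \<bullet> x" and G = "\<lambda>_. e" and G' = "\<lambda>_. 0"])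
    show "((\<lambda>x. e \<bullet> x) has_derivative (\<lambda>h. e \<bullet> h)) (at x)" for x
      by (auto intro!: derivative_eq_intros)
    show "\<forall>\<^sub>F y in at p within M. e \<bullet> y \<le> e \<bullet> p" using max by (auto simp: eventually_at_filter)
  qed auto
  then show thesis using that[of \<mu>] by simp
qed

theorem theorem4p1:
  fixes \<H> :: "real^3 \<Rightarrow> real"
    and a :: "real^3" and b :: real
    and P \<Gamma> \<Omega> M :: "(real^3) set"
    and N :: "real^3 \<Rightarrow> real^3"
  assumes "Ck_on_submanifold 1 \<H> (sphere 0 1)"
    and "a \<noteq> 0" and "P = {x. a \<bullet> x = b}"
    and "\<Gamma> \<subseteq> P" and "simple_closed_curve \<Gamma>"
    and "bounds_domain_in P \<Gamma> \<Omega>"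
    and "compact M" and "embedded_H_surface \<H> M N"
    and "spans M \<Gamma>"
    and "M \<inter> (P - closure \<Omega>) = {}"
  shows "surface_interior M \<subseteq> {x. a \<bullet> x \<le> b} \<or> surface_interior M \<subseteq> {x. a \<bullet> x \<ge> b}"
proof (rule ccontr)
  assume "\<not> ?thesis"
  then obtain p' q' where p': "p' \<in> surface_interior M" "a \<bullet> p' > b"
    and q': "q' \<in> surface_interior M" "a \<bullet> q' < b"
    unfolding subset_iff mem_Collect_eq not_le[symmetric] by blast
  note dom = Jordan_plane_domain[OF assms(2-6)]
  have bd: "surface_boundary M = \<Gamma>" using assms(9) by (simp add: spans_def)
  have M: "compact M" "embedded_surface M" "connected M" and N: "gauss_map M N"
    and Hm: "\<And>p. p \<in> M \<Longrightarrow> has_mean_curvature M N p (\<H> (N p))"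
    using assms(7,8) by (auto simp: embedded_H_surface_def)
  have H: "has_mean_curvature M N p (\<H> (N p))" if "p \<in> surface_interior M" for p
    using Hm that by (auto simp: surface_interior_def)
  have bdM: "surface_boundary M \<subseteq> M"
  proof
    fix m assume "m \<in> surface_boundary M"
    then obtain \<phi> V x where "local_param M \<phi> V" "x \<in> V" "x $ 2 = 0" "\<phi> x = m"
      by (auto simp: surface_boundary_def)
    then show "m \<in> M" using local_paramD(3)[of M \<phi> V] by (auto simp: half_plane_def)
  qed
  have bdc: "closed (surface_boundary M)" "surface_boundary M \<noteq> {}" using dom bd by auto
  define e where "e = a /\<^sub>R norm a"
  define c where "c = b / norm a"
  have na: "norm a > 0" using assms(2) by simp
  have e: "norm e = 1" using na by (simp add: e_def)
  have ea: "e \<bullet> x = (a \<bullet> x) / norm a" for x by (simp add: e_def divide_inverse_commute)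
  have P: "P = {x. e \<bullet> x = c}" using na by (simp add: assms(3) ea c_def)
  have ne: "M \<noteq> {}" using p' by (auto simp: surface_interior_def)
  have cont: "continuous_on M (\<lambda>x. e \<bullet> x)" by (intro continuous_intros)
  obtain p where p: "p \<in> M" "\<And>x. x \<in> M \<Longrightarrow> e \<bullet> x \<le> e \<bullet> p"
    using continuous_attains_sup[OF M(1) ne cont] by blast
  obtain q where q: "q \<in> M" "\<And>x. x \<in> M \<Longrightarrow> e \<bullet> q \<le> e \<bullet> x"
    using continuous_attains_inf[OF M(1) ne cont] by blast
  have "e \<bullet> p' > c" "e \<bullet> q' < c" using p' q' na by (auto simp: ea c_def divide_strict_right_mono)
  moreover have "p' \<in> M" "q' \<in> M" using p' q' by (auto simp: surface_interior_def)
  ultimately have pc: "e \<bullet> p > c" and qc: "e \<bullet> q < c" using p(2)[of p'] q(2)[of q'] by auto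
  have bdP: "surface_boundary M \<subseteq> {x. e \<bullet> x = c}" using assms(4) bd P by simp
  have pint: "p \<in> surface_interior M" and qint: "q \<in> surface_interior M"
    using p q pc qc bdP by (auto simp: surface_interior_def)
  have Npq: "N p = N q"
    by (rule normals_at_extremal_points_agree[OF M N bdc bdM H e P dom(2,1,6,5) _ _ _ assms(10)
        p(1) pc p(2) q(1) qc q(2)])
       (use dom bd assms(4) in auto)
  obtain \<mu> where \<mu>: "e = \<mu> *\<^sub>R N p" "\<mu> * \<H> (N p) \<le> 0"
    by (rule mean_curvature_sign_at_extremal_point[OF N pint H[OF pint] p(2)])
  obtain \<mu>' where \<mu>': "- e = \<mu>' *\<^sub>R N q" "\<mu>' * \<H> (N q) \<le> 0"
    by (rule mean_curvature_sign_at_extremal_point[OF N qint H[OF qint], of "- e"]) (use q in auto)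
  define \<nu> where "\<nu> = N p"
  have \<nu>: "norm \<nu> = 1" using gauss_mapD(1)[OF N p(1)] by (simp add: \<nu>_def)
  have mu: "\<bar>\<mu>\<bar> = 1" 
  proof -
    have "norm e = \<bar>\<mu>\<bar> * norm \<nu>" unfolding \<nu>_def by (subst \<mu>(1)) (rule norm_scaleR)
    then show ?thesis using e \<nu> by simp
  qed
  have "\<mu> *\<^sub>R \<nu> = e" "\<mu>' *\<^sub>R \<nu> = - e" using \<mu>(1) \<mu>'(1) Npq by (simp_all add: \<nu>_def)
  then have "(\<mu> + \<mu>') *\<^sub>R \<nu> = 0" by (simp add: scaleR_add_left)
  moreover have "\<nu> \<noteq> 0" using \<nu> by auto
  ultimately have "\<mu>' = - \<mu>" by simp
  \<comment> \<open>the orientation is the same at p and q, but the inequalities there have opposite signs\<close>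
  then have "\<mu> * \<H> \<nu> = 0" using \<mu>(2) \<mu>'(2) Npq by (simp add: \<nu>_def)
  then have H0: "\<H> \<nu> = 0" using mu by auto
  have "\<nu> \<in> sphere 0 1" using \<nu> by simp
  then obtain K \<rho> where K: "K \<ge> 0" "\<rho> > 0"
    "\<And>x. x \<in> sphere 0 1 \<Longrightarrow> norm (x - \<nu>) < \<rho> \<Longrightarrow> norm (\<H> x - \<H> \<nu>) \<le> K * norm (x - \<nu>)"
    by (rule Ck_on_submanifold_1_imp_lipschitz_at[OF assms(1)]) auto
  have "e \<bullet> q = e \<bullet> p"
  proof (rule touching_plane_principle[OF M N bdc(1) H \<nu> _ _ K(1,2)])
    show "e = \<mu> *\<^sub>R \<nu>" using \<mu>(1) by (simp add: \<nu>_def)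
    show "\<mu> = 1 \<or> \<mu> = -1" using mu by auto
    show "\<bar>\<H> n\<bar> \<le> K * norm (n - \<nu>)" if "norm n = 1" "norm (n - \<nu>) < \<rho>" for n
      using K(3)[of n] that H0 by simp
    show "x \<in> surface_interior M" if "x \<in> M" "e \<bullet> x = e \<bullet> p" for x
      using that pc bdP by (auto simp: surface_interior_def)
  qed (use p q in \<open>auto simp: \<nu>_def\<close>)
  then show False using pc qc by simp
qed

end
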